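(* The following are equivalent: (1) The sets $\mathrm{Fix}_k(\sigma)^\circ$ are closed in $X$ for all $k\in\mathbb{Z}$. (2) There exists a (not necessarily continuous) projection $E'$ from $\ell^1(\Sigma)$ onto $C(X)'_1$ which is positive in the sense that $\phi(E'(\ell))\ge0$ for all $\ell\in\ell^1(\Sigma)_+$ and all states $\phi$ of $C(X)'_1$. In that case a projection as in (2) is unique. Denoting it by $E'$ and denoting by $\chi_k$ the (continuous) characteristic function of $\mathrm{Fix}_k(\sigma)^\circ$, it is given by $E'\big(\sum_kf_k\delta^k\big)=\sum_k\chi_kf_k\delta^k$ for $\sum_kf_k\delta^k\in\ell^1(\Sigma)$. Furthermore, $E'$ is a faithful involutive norm one projection, is a morphism of $C(X)'_1$-bimodules, and restricts to a projection from $c_{00}(\Sigma)$ onto $C(X)'_{00}$.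
   Context: Let $X$ be a non-empty compact Hausdorff space and $\sigma:X\to X$ a homeomorphism; $\mathrm{Fix}_k(\sigma)=\{x:\sigma^kx=x\}$ and superscript $\circ$ denotes interior. $C(X)$ is the algebra of continuous complex functions with sup norm, $\alpha(f)=f\circ\sigma^{-1}$. $\ell^1(\Sigma)$ is the set of $\ell:\mathbb{Z}\to C(X)$ with $\|\ell\|=\sum_k\|\ell(k)\|_\infty<\infty$, product $(\ell\ell')(n)=\sum_k\ell(k)\alpha^k(\ell'(n-k))$, involution $\ell^*(n)=\overline{\alpha^n(\ell(-n))}$; it is a unital Banach $*$-algebra. With $\delta$ the element equal to the constant $1$ at $1\in\mathbb{Z}$ and $0$ elsewhere, elements are written $\sum_kf_k\delta^k$ ($f_k=\ell(k)$), and $C(X)$ is embedded as $\{f\delta^0\}$. $c_{00}(\Sigma)$ is the $*$-subalgebra of finite sums. $C(X)'_1$ and $C(X)'_{00}$ are the commutants of $C(X)$ in $\ell^1(\Sigma)$ and in $c_{00}(\Sigma)$. The positive cone $\ell^1(\Sigma)_+$ is the set of all finite sums $\sum_j\ell_j^*\ell_j$, $\ell_j\in\ell^1(\Sigma)$; a linear map on $\ell^1(\Sigma)$ is faithful if $0$ is the only element of $\ell^1(\Sigma)_+$ in its kernel. A state of $C(X)'_1$ is a linear functional $\phi$ with $\phi(a^*a)\ge0$ and $\phi(1)=1$. A projection onto $C(X)'_1$ is a linear idempotent map with range $C(X)'_1$; involutive means $E'(\ell^* )=E'(\ell)^*$. *)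

theory Defs
  imports "HOL-Analysis.Analysis"
begin

text \<open>Elements of l1(Sigma) are represented as maps  int => ('a => complex).
  Elements of C(X) are continuous maps 'a => complex (X = UNIV of a compact Hausdorff type).\<close>

type_synonym 'a elt = "int \<Rightarrow> 'a \<Rightarrow> complex"

definition sigpow :: "('a \<Rightarrow> 'a) \<Rightarrow> int \<Rightarrow> 'a \<Rightarrow> 'a" where
  "sigpow \<sigma> k = (if 0 \<le> k then \<sigma> ^^ nat k else inv \<sigma> ^^ nat (- k))"

definition Fix :: "('a \<Rightarrow> 'a) \<Rightarrow> int \<Rightarrow> 'a set" where
  "Fix \<sigma> k = {x. sigpow \<sigma> k x = x}"

definition contfun :: "('a::topological_space \<Rightarrow> complex) \<Rightarrow> bool" where
  "contfun f \<longleftrightarrow> continuous_on UNIV f"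

definition supnorm :: "('a \<Rightarrow> complex) \<Rightarrow> real" where
  "supnorm f = (SUP x. cmod (f x))"

definition l1space :: "'a::topological_space elt set" where
  "l1space = {a. (\<forall>k. contfun (a k)) \<and> (\<lambda>k. supnorm (a k)) summable_on UNIV}"

definition l1norm :: "'a elt \<Rightarrow> real" where
  "l1norm a = (\<Sum>\<^sub>\<infinity>k. supnorm (a k))"

text \<open>(a a')(n) = sum_k a(k) alpha^k(a'(n-k)),  alpha^k(f) = f o sigma^(-k)\<close>
definition lmult :: "('a \<Rightarrow> 'a) \<Rightarrow> 'a elt \<Rightarrow> 'a elt \<Rightarrow> 'a elt" where
  "lmult \<sigma> a b = (\<lambda>n x. \<Sum>\<^sub>\<infinity>k. a k x * b (n - k) (sigpow \<sigma> (- k) x))"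

text \<open>a*(n) = conj(alpha^n(a(-n)))\<close>
definition lstar :: "('a \<Rightarrow> 'a) \<Rightarrow> 'a elt \<Rightarrow> 'a elt" where
  "lstar \<sigma> a = (\<lambda>n x. cnj (a (- n) (sigpow \<sigma> (- n) x)))"

definition ladd :: "'a elt \<Rightarrow> 'a elt \<Rightarrow> 'a elt" where
  "ladd a b = (\<lambda>n x. a n x + b n x)"

definition lscale :: "complex \<Rightarrow> 'a elt \<Rightarrow> 'a elt" where
  "lscale c a = (\<lambda>n x. c * a n x)"

definition lzero :: "'a elt" where
  "lzero = (\<lambda>n x. 0)"

definition emb :: "('a \<Rightarrow> complex) \<Rightarrow> 'a elt" where
  "emb f = (\<lambda>n. if n = 0 then f else (\<lambda>x. 0))"

definition lone :: "'a elt" where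
  "lone = emb (\<lambda>x. 1)"

definition c00space :: "'a::topological_space elt set" where
  "c00space = {a \<in> l1space. finite {k. a k \<noteq> (\<lambda>x. 0)}}"

definition comm1 :: "('a::topological_space \<Rightarrow> 'a) \<Rightarrow> 'a elt set" where
  "comm1 \<sigma> = {a \<in> l1space. \<forall>f. contfun f \<longrightarrow> lmult \<sigma> (emb f) a = lmult \<sigma> a (emb f)}"

definition comm00 :: "('a::topological_space \<Rightarrow> 'a) \<Rightarrow> 'a elt set" where
  "comm00 \<sigma> = {a \<in> c00space. \<forall>f. contfun f \<longrightarrow> lmult \<sigma> (emb f) a = lmult \<sigma> a (emb f)}"

definition poscone :: "('a::topological_space \<Rightarrow> 'a) \<Rightarrow> 'a elt set" where
  "poscone \<sigma> = {a. \<exists>(m::nat) ls. (\<forall>j<m. ls j \<in> l1space) \<and>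
      a = (\<lambda>n x. \<Sum>j<m. lmult \<sigma> (lstar \<sigma> (ls j)) (ls j) n x)}"

definition nonneg :: "complex \<Rightarrow> bool" where
  "nonneg z \<longleftrightarrow> Im z = 0 \<and> 0 \<le> Re z"

definition is_state :: "('a::topological_space \<Rightarrow> 'a) \<Rightarrow> ('a elt \<Rightarrow> complex) \<Rightarrow> bool" where
  "is_state \<sigma> \<phi> \<longleftrightarrow>
     (\<forall>a\<in>comm1 \<sigma>. \<forall>b\<in>comm1 \<sigma>. \<phi> (ladd a b) = \<phi> a + \<phi> b) \<and>
     (\<forall>a\<in>comm1 \<sigma>. \<forall>c. \<phi> (lscale c a) = c * \<phi> a) \<and>
     (\<forall>a\<in>comm1 \<sigma>. nonneg (\<phi> (lmult \<sigma> (lstar \<sigma> a) a))) \<and>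
     \<phi> lone = 1"

definition is_proj :: "('a::topological_space \<Rightarrow> 'a) \<Rightarrow> ('a elt \<Rightarrow> 'a elt) \<Rightarrow> bool" where
  "is_proj \<sigma> E \<longleftrightarrow>
     (\<forall>a\<in>l1space. \<forall>b\<in>l1space. E (ladd a b) = ladd (E a) (E b)) \<and>
     (\<forall>a\<in>l1space. \<forall>c. E (lscale c a) = lscale c (E a)) \<and>
     (\<forall>a\<in>l1space. E (E a) = E a) \<and>
     E ` l1space = comm1 \<sigma>"

definition is_pos_proj :: "('a::topological_space \<Rightarrow> 'a) \<Rightarrow> ('a elt \<Rightarrow> 'a elt) \<Rightarrow> bool" where
  "is_pos_proj \<sigma> E \<longleftrightarrow> is_proj \<sigma> E \<and>
     (\<forall>a\<in>poscone \<sigma>. \<forall>\<phi>. is_state \<sigma> \<phi> \<longrightarrow> nonneg (\<phi> (E a)))"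

definition faithful :: "('a::topological_space \<Rightarrow> 'a) \<Rightarrow> ('a elt \<Rightarrow> 'a elt) \<Rightarrow> bool" where
  "faithful \<sigma> E \<longleftrightarrow> (\<forall>a\<in>poscone \<sigma>. E a = lzero \<longrightarrow> a = lzero)"

definition involutive :: "('a::topological_space \<Rightarrow> 'a) \<Rightarrow> ('a elt \<Rightarrow> 'a elt) \<Rightarrow> bool" where
  "involutive \<sigma> E \<longleftrightarrow> (\<forall>a\<in>l1space. E (lstar \<sigma> a) = lstar \<sigma> (E a))"

definition norm_one :: "('a::topological_space elt \<Rightarrow> 'a elt) \<Rightarrow> bool" where
  "norm_one E \<longleftrightarrow> (\<forall>a\<in>l1space. l1norm (E a) \<le> l1norm a) \<and>
     (\<exists>a\<in>l1space. a \<noteq> lzero \<and> l1norm (E a) = l1norm a)"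

definition bimodule_morphism :: "('a::topological_space \<Rightarrow> 'a) \<Rightarrow> ('a elt \<Rightarrow> 'a elt) \<Rightarrow> bool" where
  "bimodule_morphism \<sigma> E \<longleftrightarrow> (\<forall>a\<in>comm1 \<sigma>. \<forall>b\<in>comm1 \<sigma>. \<forall>l\<in>l1space.
     E (lmult \<sigma> (lmult \<sigma> a l) b) = lmult \<sigma> (lmult \<sigma> a (E l)) b)"

end

theory Submission
  imports Defs
begin

text \<open>
  The commutant of \<open>C(X)\<close> consists of the \<open>\<Sum>\<^sub>k f\<^sub>k \<delta>\<^sup>k\<close> with \<open>f\<^sub>k\<close> supported in the interior of
  \<open>Fix\<^sub>k\<close>, and on it the product is a pointwise convolution.

  Uniqueness. Let \<open>E\<close> be a positive projection. Compose it with the states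
  \<open>a \<mapsto> a\<^sub>0(x) + (cnj w a\<^sub>n(x) + w a\<^sub>-\<^sub>n(x)) / 2\<close>, \<open>|w| \<le> 1\<close>, which separate the commutant and restrict
  to the character \<open>f \<mapsto> f x\<close> of \<open>C(X)\<close>. By Cauchy-Schwarz \<open>C(X)\<close> lies in the multiplicative domain of
  each composition, so \<open>E\<close> is \<open>C(X)\<close>-linear on both sides. Comparing \<open>g \<delta>\<^sup>k f\<close> with
  \<open>(f \<circ> \<sigma>\<^sup>-\<^sup>k) g \<delta>\<^sup>k\<close> shows that \<open>E (g \<delta>\<^sup>k)\<close> vanishes off the interior of \<open>Fix\<^sub>k\<close>, and on that
  interior it agrees with \<open>g \<delta>\<^sup>k\<close>. For \<open>g = 1\<close> this makes the interior clopen. Passing from finite to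
  infinite sums needs no continuity of \<open>E\<close>: positive functionals are bounded because \<open>1 + a\<close> has a
  self-adjoint square root, given by the binomial series, whenever \<open>a\<close> is self-adjoint of norm below 1.

  Existence. For \<open>l\<close> with finite support \<open>K\<close>, group the elements of \<open>K\<close> at each point \<open>x\<close> into cosets of
  the group of all \<open>n\<close> with \<open>x\<close> in the interior of \<open>Fix\<^sub>n\<close>. Splitting \<open>l\<close> along the cosets and
  translating each part back by its least representative writes \<open>E (l\<^sup>* l)\<close> as a finite sum of squares
  from the commutant. The general case follows from boundedness of states.
\<close>

subsection \<open>Summation over pairs and integers\<close>

lemma has_sum_product_pairs:
  fixes u :: "'i \<Rightarrow> real" and v :: "'j \<Rightarrow> real"
  assumes "u summable_on UNIV" "v summable_on UNIV" "\<And>i. 0 \<le> u i" "\<And>j. 0 \<le> v j"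
  shows "((\<lambda>(i,j). u i * v j) has_sum (infsum u UNIV * infsum v UNIV)) (UNIV \<times> UNIV)"
proof (rule has_sum_SigmaI)
  show *: "((\<lambda>y. case (x, y) of (i, j) \<Rightarrow> u i * v j) has_sum (u x * infsum v UNIV)) UNIV" for x
    using assms by (auto intro!: has_sum_cmult_right)
  show **: "((\<lambda>x. u x * infsum v UNIV) has_sum infsum u UNIV * infsum v UNIV) UNIV"
    using assms by (auto intro!: has_sum_cmult_left)
  show "(\<lambda>(i, j). u i * v j) summable_on UNIV \<times> UNIV"
    by (rule summable_on_SigmaI[OF *]) (use assms ** in \<open>auto intro: has_sum_imp_summable\<close>)
qed

text \<open>The change of variables (n, k) -> (k, n - k) turns the family into a product
  family.\<close>

lemma has_sum_convolution_pairs: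
  fixes u v :: "int \<Rightarrow> real"
  assumes "u summable_on UNIV" "v summable_on UNIV" "\<And>i. 0 \<le> u i" "\<And>j. 0 \<le> v j"
  shows "((\<lambda>(n,k). u k * v (n - k)) has_sum (infsum u UNIV * infsum v UNIV)) (UNIV \<times> UNIV)"
proof -
  have "((\<lambda>(n,k). u k * v (n - k)) has_sum (infsum u UNIV * infsum v UNIV)) (UNIV \<times> UNIV)
    \<longleftrightarrow> ((\<lambda>(i,j). u i * v j) has_sum (infsum u UNIV * infsum v UNIV)) (UNIV \<times> UNIV)"
    by (rule has_sum_reindex_bij_witness[of _ "\<lambda>(i,j). (i+j,i)" "\<lambda>(n,k). (k,n-k)"]) auto
  thus ?thesis using has_sum_product_pairs[OF assms] by simp
qed

lemma summable_convolution:
  fixes u v :: "int \<Rightarrow> real"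
  assumes "u summable_on UNIV" "v summable_on UNIV" "\<And>i. 0 \<le> u i" "\<And>j. 0 \<le> v j"
  shows "(\<lambda>k. u k * v (n - k)) summable_on UNIV"
  using summable_on_SigmaD1[OF has_sum_imp_summable[OF has_sum_convolution_pairs[OF assms]], of n]
  by simp

lemma has_sum_convolution:
  fixes u v :: "int \<Rightarrow> real"
  assumes "u summable_on UNIV" "v summable_on UNIV" "\<And>i. 0 \<le> u i" "\<And>j. 0 \<le> v j"
  shows "((\<lambda>n. \<Sum>\<^sub>\<infinity>k. u k * v (n - k)) has_sum (infsum u UNIV * infsum v UNIV)) UNIV"
proof (rule has_sum_Sigma'[OF has_sum_convolution_pairs[OF assms]])
  show "((\<lambda>y. case (n, y) of (n, k) \<Rightarrow> u k * v (n - k)) has_sum (\<Sum>\<^sub>\<infinity>k. u k * v (n - k))) UNIV" for n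
    using summable_convolution[OF assms] by simp
qed

lemma complex_summable_comparison:
  fixes f :: "'i \<Rightarrow> complex"
  assumes "g summable_on A" "\<And>i. i \<in> A \<Longrightarrow> cmod (f i) \<le> g i"
  shows "f summable_on A" "cmod (infsum f A) \<le> infsum g A"
proof -
  show s: "f summable_on A"
    using Infinite_Sum.abs_summable_on_comparison_test'[OF assms] by (auto intro: abs_summable_summable)
  show "cmod (infsum f A) \<le> infsum g A"
    by (rule norm_infsum_le[of f A _ g]) (use s assms in auto)
qed

lemma infsum_single:
  fixes f :: "'i \<Rightarrow> 'b::{comm_monoid_add,t2_space}"
  assumes "\<And>k. k \<noteq> m \<Longrightarrow> f k = 0"
  shows "(\<Sum>\<^sub>\<infinity>k. f k) = f m"
proof -
  have "(\<Sum>\<^sub>\<infinity>k. f k) = (\<Sum>\<^sub>\<infinity>k\<in>{m}. f k)"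
    by (rule infsum_cong_neutral) (use assms in auto)
  thus ?thesis by simp
qed

lemma infsum_int_shift:
  fixes f :: "int \<Rightarrow> 'b::{comm_monoid_add,t2_space}"
  shows "(\<Sum>\<^sub>\<infinity>k. f (k + m)) = (\<Sum>\<^sub>\<infinity>k. f k)"
  by (rule infsum_reindex_bij_witness[of _ "\<lambda>k. k - m" "\<lambda>k. k + m"]) auto

lemma infsum_int_minus:
  fixes f :: "int \<Rightarrow> 'b::{comm_monoid_add,t2_space}"
  shows "(\<Sum>\<^sub>\<infinity>k. f (- k)) = (\<Sum>\<^sub>\<infinity>k. f k)"
  by (rule infsum_reindex_bij_witness[of _ "\<lambda>k. - k" "\<lambda>k. - k"]) auto

subsection \<open>The Banach *-algebra\<close>

locale compact_dynamics =
  fixes \<sigma> :: "'a::t2_space \<Rightarrow> 'a"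
  assumes compact_UNIV: "compact (UNIV :: 'a set)"
    and bij_\<sigma>: "bij \<sigma>"
    and cont_\<sigma>: "continuous_on UNIV \<sigma>"
    and cont_inv_\<sigma>: "continuous_on UNIV (inv \<sigma>)"
begin

abbreviation s :: "int \<Rightarrow> 'a \<Rightarrow> 'a" where "s \<equiv> sigpow \<sigma>"
abbreviation mul :: "'a elt \<Rightarrow> 'a elt \<Rightarrow> 'a elt" (infixl "\<odot>" 70) where "a \<odot> b \<equiv> lmult \<sigma> a b"
abbreviation adj :: "'a elt \<Rightarrow> 'a elt" where "adj \<equiv> lstar \<sigma>"

section \<open>Integer powers of the homeomorphism\<close>

lemma sigpow_0 [simp]: "s 0 x = x"
  by (simp add: sigpow_def)

lemma sigpow_succ: "s (k + 1) x = \<sigma> (s k x)"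
proof (cases "0 \<le> k")
  case True
  then have "nat (k + 1) = Suc (nat k)" by simp
  with True show ?thesis by (simp add: sigpow_def)
next
  case False
  then have "nat (- k) = Suc (nat (- (k + 1)))" by simp
  then have "s k x = inv \<sigma> ((inv \<sigma> ^^ nat (- (k + 1))) x)"
    using False by (simp add: sigpow_def)
  moreover have "s (k + 1) x = (inv \<sigma> ^^ nat (- (k + 1))) x"
    using False by (cases "k = -1") (auto simp: sigpow_def)
  ultimately show ?thesis
    using bij_\<sigma> by (simp add: bij_is_surj surj_f_inv_f)
qed

lemma sigpow_pred: "s (k - 1) x = inv \<sigma> (s k x)"
  using sigpow_succ[of "k - 1" x] bij_\<sigma> by (simp add: bij_is_inj)

lemma sigpow_add: "s (j + k) x = s j (s k x)"
proof (induction j rule: int_induct[where k = 0])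
  case (step1 i)
  have "s (i + 1 + k) x = \<sigma> (s (i + k) x)" using sigpow_succ[of "i + k" x] by (simp add: algebra_simps)
  with step1 show ?case by (simp add: sigpow_succ)
next
  case (step2 i)
  have "s (i - 1 + k) x = inv \<sigma> (s (i + k) x)" using sigpow_pred[of "i + k" x] by (simp add: algebra_simps)
  with step2 show ?case by (simp add: sigpow_pred)
qed simp

lemma sigpow_inverse [simp]: "s (- k) (s k x) = x" "s k (s (- k) x) = x"
  by (simp_all flip: sigpow_add)

lemma sigpow_commute: "s j (s k x) = s k (s j x)"
  by (metis add.commute sigpow_add)

lemma continuous_sigpow: "continuous_on UNIV (s k)"
proof (induction k rule: int_induct[where k = 0])
  case base
  show ?case by (simp cong: continuous_on_cong)
next
  case (step1 i)
  have "s (i + 1) = \<sigma> \<circ> s i" by (auto simp: sigpow_succ)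
  thus ?case using step1 cont_\<sigma> by (metis continuous_on_compose continuous_on_subset subset_UNIV)
next
  case (step2 i)
  have "s (i - 1) = inv \<sigma> \<circ> s i" by (auto simp: sigpow_pred)
  thus ?case using step2 cont_inv_\<sigma> by (metis continuous_on_compose continuous_on_subset subset_UNIV)
qed

lemma contfun_sigpow: "contfun f \<Longrightarrow> contfun (\<lambda>x. f (s k x))"
  unfolding contfun_def by (rule continuous_on_compose2[OF _ continuous_sigpow]) auto

section \<open>Sup norm and l1 norm\<close>

lemma bdd_above_cmod:
  fixes f :: "'a \<Rightarrow> complex"
  assumes "contfun f" shows "bdd_above (range (\<lambda>x. cmod (f x)))"
proof -
  have "compact (range (\<lambda>x. cmod (f x)))"
    using assms compact_UNIV unfolding contfun_def
    by (intro compact_continuous_image continuous_intros)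
  thus ?thesis by (simp add: bounded_imp_bdd_above compact_imp_bounded)
qed

lemma cmod_le_supnorm: 
  fixes f :: "'a \<Rightarrow> complex"
  shows "contfun f \<Longrightarrow> cmod (f x) \<le> supnorm f"
  unfolding supnorm_def by (rule cSUP_upper[OF _ bdd_above_cmod]) auto

lemma supnorm_le: "(\<And>x. cmod (f x) \<le> M) \<Longrightarrow> supnorm f \<le> M"
  unfolding supnorm_def by (rule cSUP_least) auto

lemma supnorm_nonneg: 
  fixes f :: "'a \<Rightarrow> complex"
  shows "contfun f \<Longrightarrow> 0 \<le> supnorm f"
  using cmod_le_supnorm[of f undefined] norm_ge_zero order_trans by blast

lemma l1_contfun: "a \<in> l1space \<Longrightarrow> contfun (a k)"
  by (simp add: l1space_def)

lemma l1_summable: "a \<in> l1space \<Longrightarrow> (\<lambda>k. supnorm (a k)) summable_on UNIV"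
  by (simp add: l1space_def)

lemma l1_supnorm_nonneg: "(a :: 'a elt) \<in> l1space \<Longrightarrow> 0 \<le> supnorm (a k)"
  by (simp add: l1space_def supnorm_nonneg)

lemma l1_cmod_le: "(a :: 'a elt) \<in> l1space \<Longrightarrow> cmod (a k x) \<le> supnorm (a k)"
  by (simp add: l1space_def cmod_le_supnorm)

text \<open>A summable pointwise majorant of the coefficients gives membership and a norm bound at
  once; most closure properties below are proved in this form.\<close>

lemma l1I:
  fixes a :: "'a elt"
  assumes "\<And>k. contfun (a k)" "\<And>k x. cmod (a k x) \<le> M k" "M summable_on UNIV"
  shows "a \<in> l1space" "l1norm a \<le> infsum M UNIV"
proof -
  have *: "(\<lambda>k. supnorm (a k)) summable_on UNIV"
    by (rule summable_on_comparison_test[OF assms(3)])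
       (use assms in \<open>auto intro: supnorm_le supnorm_nonneg\<close>)
  then show "a \<in> l1space" using assms by (simp add: l1space_def)
  show "l1norm a \<le> infsum M UNIV"
    unfolding l1norm_def by (rule infsum_mono[OF * assms(3)]) (use assms in \<open>auto intro: supnorm_le\<close>)
qed

lemma l1norm_nonneg: "(a :: 'a elt) \<in> l1space \<Longrightarrow> 0 \<le> l1norm a"
  unfolding l1norm_def by (rule infsum_nonneg) (simp add: l1_supnorm_nonneg)

lemma supnorm_le_l1norm: "(a :: 'a elt) \<in> l1space \<Longrightarrow> supnorm (a k) \<le> l1norm a"
  unfolding l1norm_def
  using finite_sum_le_infsum[of "\<lambda>k. supnorm (a k)" UNIV "{k}"]
  by (auto simp: l1_summable l1_supnorm_nonneg)

lemma cmod_le_l1norm: "(a :: 'a elt) \<in> l1space \<Longrightarrow> cmod (a k x) \<le> l1norm a"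
  using l1_cmod_le supnorm_le_l1norm order_trans by blast

text \<open>Weierstrass M-test along the net of finite index sets: the continuous partial sums
  converge uniformly.\<close>

lemma contfun_infsum:
  fixes f :: "'i \<Rightarrow> 'a \<Rightarrow> complex"
  assumes "\<And>k. contfun (f k)" "\<And>k x. cmod (f k x) \<le> M k" "M summable_on UNIV"
  shows "contfun (\<lambda>x. \<Sum>\<^sub>\<infinity>k. f k x)"
  unfolding contfun_def
proof (rule uniform_limit_theorem)
  show "uniform_limit UNIV (\<lambda>K x. \<Sum>k\<in>K. f k x) (\<lambda>x. \<Sum>\<^sub>\<infinity>k. f k x) (finite_subsets_at_top UNIV)"
    using assms by (intro Weierstrass_m_test_general) auto
  show "\<forall>\<^sub>F K in finite_subsets_at_top UNIV. continuous_on UNIV (\<lambda>x. \<Sum>k\<in>K. f k x)"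
    using assms by (intro always_eventually allI continuous_on_sum) (auto simp: contfun_def)
qed simp

section \<open>Convolution product and involution\<close>

lemma lmult_term_le:
  fixes a b :: "'a elt"
  assumes "a \<in> l1space" "b \<in> l1space"
  shows "cmod (a k x * b l y) \<le> supnorm (a k) * supnorm (b l)"
  unfolding norm_mult by (intro mult_mono l1_cmod_le assms l1_supnorm_nonneg) auto

lemma lmult_summable:
  fixes a b :: "'a elt"
  assumes "a \<in> l1space" "b \<in> l1space"
  shows "(\<lambda>k. a k x * b (n - k) (y k)) summable_on UNIV"
  by (rule complex_summable_comparison(1)[OF summable_convolution[of "\<lambda>k. supnorm (a k)" "\<lambda>k. supnorm (b k)"]])
     (use assms in \<open>auto intro: l1_summable l1_supnorm_nonneg lmult_term_le\<close>)

text \<open>The n-th coefficient is dominated by the n-th term of the convolution of the two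
  sequences of sup norms, and these terms sum to the product of the norms.\<close>

lemma lmult_l1:
  assumes "a \<in> l1space" "b \<in> l1space"
  shows "a \<odot> b \<in> l1space" "l1norm (a \<odot> b) \<le> l1norm a * l1norm b"
proof -
  let ?u = "\<lambda>k. supnorm (a k)" and ?v = "\<lambda>k. supnorm (b k)"
  have uv: "?u summable_on UNIV" "?v summable_on UNIV" "\<And>k. 0 \<le> ?u k" "\<And>k. 0 \<le> ?v k"
    using assms by (auto intro: l1_summable l1_supnorm_nonneg)
  have 1: "contfun ((a \<odot> b) n)" for n
    unfolding lmult_def
  proof (rule contfun_infsum)
    show "contfun (\<lambda>x. a k x * b (n - k) (s (- k) x))" for k
      using contfun_sigpow[OF l1_contfun[OF assms(2)]] l1_contfun[OF assms(1)]
      by (auto simp: contfun_def intro!: continuous_intros)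
    show "cmod (a k x * b (n - k) (s (- k) x)) \<le> ?u k * ?v (n - k)" for k x
      by (rule lmult_term_le[OF assms])
    show "(\<lambda>k. ?u k * ?v (n - k)) summable_on UNIV"
      by (rule summable_convolution[OF uv])
  qed
  have 2: "cmod ((a \<odot> b) n x) \<le> (\<Sum>\<^sub>\<infinity>k. ?u k * ?v (n - k))" for n x
    unfolding lmult_def
    by (rule complex_summable_comparison(2)[OF summable_convolution[OF uv]])
       (use assms in \<open>auto intro: lmult_term_le\<close>)
  note 3 = has_sum_convolution[OF uv]
  show "a \<odot> b \<in> l1space" using l1I(1)[OF 1 2 has_sum_imp_summable[OF 3]] .
  show "l1norm (a \<odot> b) \<le> l1norm a * l1norm b"
    using l1I(2)[OF 1 2 has_sum_imp_summable[OF 3]] infsumI[OF 3] by (simp add: l1norm_def)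
qed

text \<open>Both sides are iterated sums of one family \<open>t\<close>, which is absolutely
  summable over pairs, so the order of summation can be exchanged.\<close>

lemma lmult_assoc:
  assumes "a \<in> l1space" "b \<in> l1space" "c \<in> l1space"
  shows "(a \<odot> b) \<odot> c = a \<odot> (b \<odot> c)"
proof (intro ext)
  fix n x
  let ?u = "\<lambda>k. supnorm (a k)" and ?v = "\<lambda>k. supnorm (b k)"
  have uv: "?u summable_on UNIV" "?v summable_on UNIV" "\<And>k. 0 \<le> ?u k" "\<And>k. 0 \<le> ?v k"
    using assms by (auto intro: l1_summable l1_supnorm_nonneg)
  define t where "t j k = a k x * b (j - k) (s (- k) x) * c (n - j) (s (- j) x)" for j k
  have t_summable: "(\<lambda>(j,k). t j k) summable_on UNIV \<times> UNIV"
  proof (rule complex_summable_comparison(1))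
    show "(\<lambda>p. (case p of (j,k) \<Rightarrow> ?u k * ?v (j - k)) * l1norm c) summable_on UNIV \<times> UNIV"
      by (intro summable_on_cmult_left has_sum_imp_summable[OF has_sum_convolution_pairs[OF uv]])
    show "cmod (case p of (j,k) \<Rightarrow> t j k) \<le> (case p of (j,k) \<Rightarrow> ?u k * ?v (j - k)) * l1norm c" for p
      unfolding t_def case_prod_beta norm_mult[of "_ * _"]
      by (intro mult_mono lmult_term_le cmod_le_l1norm assms mult_nonneg_nonneg uv) auto
  qed
  have "((a \<odot> b) \<odot> c) n x = (\<Sum>\<^sub>\<infinity>j. \<Sum>\<^sub>\<infinity>k. t j k)"
    by (simp add: lmult_def t_def flip: infsum_cmult_left')
  also have "\<dots> = (\<Sum>\<^sub>\<infinity>k. \<Sum>\<^sub>\<infinity>j. t j k)"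
    by (rule infsum_swap_banach[OF t_summable])
  \<comment> \<open>With j = i + k the inner sum becomes, up to the factor \<open>a k x\<close>, the
    coefficient of \<open>b \<odot> c\<close> at n - k, evaluated at
    \<open>s (- k) x\<close>.\<close>
  also have "\<dots> = (\<Sum>\<^sub>\<infinity>k. \<Sum>\<^sub>\<infinity>i. t (i + k) k)"
    by (simp only: infsum_int_shift[of "\<lambda>j. t j k" k for k])
  also have "\<dots> = (a \<odot> (b \<odot> c)) n x"
    by (simp add: lmult_def t_def sigpow_add[of "- i" "- k" for i k] algebra_simps
        flip: infsum_cmult_right' sigpow_add)
  finally show "((a \<odot> b) \<odot> c) n x = (a \<odot> (b \<odot> c)) n x" .
qed

lemma lstar_apply: "adj a n x = cnj (a (- n) (s (- n) x))"
  by (simp add: lstar_def)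

lemma lstar_l1:
  assumes "a \<in> l1space"
  shows "adj a \<in> l1space" "l1norm (adj a) \<le> l1norm a"
proof -
  have sm: "(\<lambda>k. supnorm (a (- k))) summable_on UNIV"
    using l1_summable[OF assms]
    by (subst summable_on_reindex_bij_witness[of _ "\<lambda>k. - k" "\<lambda>k. - k" UNIV "\<lambda>k. supnorm (a k)"]) auto
  have 1: "contfun (adj a n)" for n
    using contfun_sigpow[OF l1_contfun[OF assms], of "-n" "-n"]
    unfolding lstar_def contfun_def by (intro continuous_intros)
  have 2: "cmod (adj a n x) \<le> supnorm (a (- n))" for n x
    using l1_cmod_le[OF assms] by (simp add: lstar_def)
  show "adj a \<in> l1space" using l1I(1)[OF 1 2 sm] .
  show "l1norm (adj a) \<le> l1norm a"
    using l1I(2)[OF 1 2 sm] infsum_int_minus[of "\<lambda>k. supnorm (a k)"] by (simp add: l1norm_def)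
qed

lemma lstar_lstar: "adj (adj a) = a"
  by (simp add: lstar_def)

lemma lstar_lmult: "adj (a \<odot> b) = adj b \<odot> adj a"
proof (intro ext)
  fix n x
  let ?f = "\<lambda>k. adj b k x * adj a (n - k) (s (- k) x)"
  have "adj (a \<odot> b) n x = (\<Sum>\<^sub>\<infinity>k. cnj (a k (s (- n) x)) * cnj (b (- n - k) (s (- k) (s (- n) x))))"
    by (simp add: lstar_def lmult_def flip: infsum_cnj)
  also have "\<dots> = (\<Sum>\<^sub>\<infinity>k. ?f (k + n))"
    by (intro infsum_cong) (simp add: lstar_def minus_diff_commute[of _ n] flip: sigpow_add)
  also have "\<dots> = (adj b \<odot> adj a) n x"
    using infsum_int_shift[of ?f n] by (simp only: lmult_def)
  finally show "adj (a \<odot> b) n x = (adj b \<odot> adj a) n x" .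
qed

section \<open>Monomials, unit and linear operations\<close>

lemma contfun_const: "contfun (\<lambda>x. c)"
  by (simp add: contfun_def)

text \<open>The monomial f \<delta>^k.\<close>

definition single :: "int \<Rightarrow> ('a \<Rightarrow> complex) \<Rightarrow> 'a elt" where
  "single k f = (\<lambda>n. if n = k then f else (\<lambda>x. 0))"

lemma single_l1: 
  assumes "contfun f" shows "single k f \<in> l1space" "l1norm (single k f) \<le> supnorm f"
proof -
  let ?M = "\<lambda>n. if n = k then supnorm f else 0"
  have 1: "contfun (single k f n)" for n
    using assms by (simp add: single_def contfun_const)
  have 2: "cmod (single k f n x) \<le> ?M n" for n x
    using cmod_le_supnorm[OF assms] by (simp add: single_def)
  have 3: "?M summable_on UNIV"
    by (rule finite_nonzero_values_imp_summable_on) (simp cong: if_cong)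
  show "single k f \<in> l1space" by (rule l1I(1)[OF 1 2 3])
  show "l1norm (single k f) \<le> supnorm f"
    using l1I(2)[OF 1 2 3] infsum_single[of k ?M] by simp
qed

lemma emb_eq_single: "emb f = single 0 f"
  by (simp add: emb_def single_def)

lemma emb_l1: "contfun (f :: 'a \<Rightarrow> complex) \<Longrightarrow> emb f \<in> l1space"
  by (simp add: emb_eq_single single_l1)

lemma lone_l1: "(lone :: 'a elt) \<in> l1space"
  by (simp add: lone_def emb_l1 contfun_const)

lemma l1norm_lone: "l1norm (lone :: 'a elt) \<le> 1"
  unfolding lone_def emb_eq_single
  by (rule order_trans[OF single_l1(2)]) (auto intro: contfun_const supnorm_le)

lemma emb_lmult: "(emb f \<odot> a) n x = f x * a n x"
  unfolding lmult_def by (subst infsum_single[of 0]) (auto simp: emb_def)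

text \<open>Functions act from the right through \<alpha>^n, whereas \<open>emb_lmult\<close> shows
  no twist on the left. The comparison of the two actions is what detects fixed points
  later.\<close>

lemma lmult_emb: "(a \<odot> emb f) n x = a n x * f (s (- n) x)"
  unfolding lmult_def by (subst infsum_single[of n]) (auto simp: emb_def)

lemma lone_lmult: "lone \<odot> a = a"
  by (intro ext) (simp add: lone_def emb_lmult)

lemma lmult_lone: "a \<odot> lone = a"
  by (intro ext) (simp add: lone_def lmult_emb)

lemma lstar_emb: "adj (emb f) = emb (\<lambda>x. cnj (f x))"
  by (intro ext) (auto simp: lstar_def emb_def)

lemma lstar_lone: "adj lone = lone"
  by (simp add: lone_def lstar_emb)

lemma ladd_l1:
  assumes "(a :: 'a elt) \<in> l1space" "b \<in> l1space"
  shows "ladd a b \<in> l1space" "l1norm (ladd a b) \<le> l1norm a + l1norm b"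
proof -
  let ?M = "\<lambda>k. supnorm (a k) + supnorm (b k)"
  have 1: "contfun (ladd a b n)" for n
    using l1_contfun[OF assms(1)] l1_contfun[OF assms(2)]
    by (auto simp: contfun_def ladd_def intro!: continuous_intros)
  have 2: "cmod (ladd a b n x) \<le> ?M n" for n x
    unfolding ladd_def using l1_cmod_le[OF assms(1)] l1_cmod_le[OF assms(2)]
    by (meson add_mono norm_triangle_le)
  have 3: "(?M has_sum (l1norm a + l1norm b)) UNIV"
    unfolding l1norm_def by (intro has_sum_add has_sum_infsum l1_summable assms)
  show "ladd a b \<in> l1space" by (rule l1I(1)[OF 1 2 has_sum_imp_summable[OF 3]])
  show "l1norm (ladd a b) \<le> l1norm a + l1norm b"
    using l1I(2)[OF 1 2 has_sum_imp_summable[OF 3]] infsumI[OF 3] by simp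
qed

lemma lscale_l1:
  assumes "(a :: 'a elt) \<in> l1space"
  shows "lscale c a \<in> l1space" "l1norm (lscale c a) \<le> cmod c * l1norm a"
proof -
  let ?M = "\<lambda>k. cmod c * supnorm (a k)"
  have 1: "contfun (lscale c a n)" for n
    using l1_contfun[OF assms(1)]
    by (auto simp: contfun_def lscale_def intro!: continuous_intros)
  have 2: "cmod (lscale c a n x) \<le> ?M n" for n x
    unfolding lscale_def norm_mult using l1_cmod_le[OF assms(1)] by (simp add: mult_left_mono)
  have 3: "(?M has_sum (cmod c * l1norm a)) UNIV"
    unfolding l1norm_def by (intro has_sum_cmult_right has_sum_infsum l1_summable assms)
  show "lscale c a \<in> l1space" by (rule l1I(1)[OF 1 2 has_sum_imp_summable[OF 3]])
  show "l1norm (lscale c a) \<le> cmod c * l1norm a"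
    using l1I(2)[OF 1 2 has_sum_imp_summable[OF 3]] infsumI[OF 3] by simp
qed

lemma lmult_ladd_left:
  assumes "a \<in> l1space" "b \<in> l1space" "c \<in> l1space"
  shows "ladd a b \<odot> c = ladd (a \<odot> c) (b \<odot> c)"
  unfolding lmult_def ladd_def ring_distribs by (intro ext infsum_add lmult_summable assms)

lemma lmult_ladd_right:
  assumes "a \<in> l1space" "b \<in> l1space" "c \<in> l1space"
  shows "c \<odot> ladd a b = ladd (c \<odot> a) (c \<odot> b)"
  unfolding lmult_def ladd_def ring_distribs by (intro ext infsum_add lmult_summable assms)

lemma lmult_lscale_left: "lscale t a \<odot> b = lscale t (a \<odot> b)"
  by (intro ext) (simp add: lmult_def lscale_def mult.assoc infsum_cmult_right')

lemma lmult_lscale_right: "a \<odot> lscale t b = lscale t (a \<odot> b)"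
  by (intro ext) (simp add: lmult_def lscale_def mult.left_commute[of _ t] infsum_cmult_right')

lemma lstar_ladd: "adj (ladd a b) = ladd (adj a) (adj b)"
  by (simp add: lstar_def ladd_def)

lemma lstar_lscale: "adj (lscale c a) = lscale (cnj c) (adj a)"
  by (simp add: lstar_def lscale_def)

text \<open>Sums are taken coefficient by coefficient; the definition is applied to sequences with
  summable norms, where this is the norm limit.\<close>

definition series :: "(nat \<Rightarrow> 'a elt) \<Rightarrow> 'a elt" where
  "series u = (\<lambda>k x. \<Sum>\<^sub>\<infinity>n. u n k x)"

lemma series_l1:
  assumes "\<And>n. u n \<in> l1space" "(\<lambda>n. l1norm (u n)) summable_on UNIV"
  shows "series u \<in> l1space"
proof -
  have has: "((\<lambda>k. supnorm (u n k)) has_sum l1norm (u n)) UNIV" for n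
    unfolding l1norm_def using l1_summable[OF assms(1)] by simp
  have "(\<lambda>(n,k). supnorm (u n k)) summable_on UNIV \<times> UNIV"
    by (rule summable_on_SigmaI[where g = "\<lambda>n. l1norm (u n)"])
       (use has assms l1_supnorm_nonneg in auto)
  then have sm: "(\<lambda>(k,n). supnorm (u n k)) summable_on UNIV \<times> UNIV"
    by (subst summable_on_swap) simp
  have smk: "(\<lambda>n. supnorm (u n k)) summable_on UNIV" for k
    using summable_on_SigmaD1[OF sm] by simp
  have 1: "contfun (series u k)" for k
    unfolding series_def
    by (rule contfun_infsum[OF _ _ assms(2)])
       (use assms in \<open>auto intro: l1_contfun cmod_le_l1norm\<close>)
  have 2: "cmod (series u k x) \<le> (\<Sum>\<^sub>\<infinity>n. supnorm (u n k))" for k x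
    unfolding series_def
    by (rule complex_summable_comparison(2)[OF smk]) (use assms in \<open>auto intro: l1_cmod_le\<close>)
  show ?thesis
    by (rule l1I(1)[OF 1 2 summable_on_Sigma_banach[OF sm]])
qed

text \<open>Instead of continuity of multiplication, two absolutely convergent sums are exchanged,
  with majorant \<open>supnorm (a k) * l1norm (u n)\<close>.\<close>

lemma lmult_series_right:
  assumes "a \<in> l1space" "\<And>n. u n \<in> l1space" "(\<lambda>n. l1norm (u n)) summable_on UNIV"
  shows "(a \<odot> series u) m x = (\<Sum>\<^sub>\<infinity>n. (a \<odot> u n) m x)"
proof -
  let ?t = "\<lambda>k n. a k x * u n (m - k) (s (- k) x)"
  have "(\<lambda>(k,n). ?t k n) summable_on UNIV \<times> UNIV"
  proof (rule complex_summable_comparison(1))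
    show "(\<lambda>(k,n). supnorm (a k) * l1norm (u n)) summable_on UNIV \<times> UNIV"
      by (rule has_sum_imp_summable[OF has_sum_product_pairs])
         (use assms in \<open>auto intro: l1_summable l1_supnorm_nonneg l1norm_nonneg\<close>)
    show "cmod (case p of (k,n) \<Rightarrow> ?t k n) \<le> (case p of (k,n) \<Rightarrow> supnorm (a k) * l1norm (u n))" for p
      unfolding case_prod_beta norm_mult
      by (intro mult_mono l1_cmod_le cmod_le_l1norm assms l1_supnorm_nonneg) auto
  qed
  from infsum_swap_banach[OF this] show ?thesis
    by (simp add: lmult_def series_def flip: infsum_cmult_right')
qed

lemma lmult_series_left:
  assumes "a \<in> l1space" "\<And>n. u n \<in> l1space" "(\<lambda>n. l1norm (u n)) summable_on UNIV"
  shows "(series u \<odot> a) m x = (\<Sum>\<^sub>\<infinity>n. (u n \<odot> a) m x)"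
proof -
  let ?t = "\<lambda>k n. u n k x * a (m - k) (s (- k) x)"
  have sa: "(\<lambda>k. supnorm (a (m - k))) summable_on UNIV"
    using l1_summable[OF assms(1)]
    by (subst summable_on_reindex_bij_witness[of _ "\<lambda>k. m - k" "\<lambda>k. m - k" UNIV "\<lambda>k. supnorm (a k)"]) auto
  have "(\<lambda>(k,n). ?t k n) summable_on UNIV \<times> UNIV"
  proof (rule complex_summable_comparison(1))
    show "(\<lambda>(k,n). supnorm (a (m - k)) * l1norm (u n)) summable_on UNIV \<times> UNIV"
      by (rule has_sum_imp_summable[OF has_sum_product_pairs[OF sa]])
         (use assms in \<open>auto intro: l1_supnorm_nonneg l1norm_nonneg\<close>)
    show "cmod (case p of (k,n) \<Rightarrow> ?t k n) \<le> (case p of (k,n) \<Rightarrow> supnorm (a (m - k)) * l1norm (u n))" for p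
      unfolding case_prod_beta norm_mult mult.commute[of "cmod (u _ _ _)"]
      by (intro mult_mono l1_cmod_le cmod_le_l1norm assms l1_supnorm_nonneg) auto
  qed
  from infsum_swap_banach[OF this] show ?thesis
    by (simp add: lmult_def series_def flip: infsum_cmult_left')
qed

end

subsection \<open>Square roots by the binomial series\<close>

text \<open>Cauchy product: the pairs (n, l) are regrouped along the diagonals n + l = N.\<close>

lemma infsum_nat_pairs_by_sum:
  fixes \<beta> :: "nat \<Rightarrow> complex" and p :: "nat \<Rightarrow> complex"
  assumes "(\<lambda>(n,l). \<beta> n * \<beta> l * p (n + l)) summable_on UNIV \<times> UNIV"
  shows "(\<Sum>\<^sub>\<infinity>n. \<beta> n * (\<Sum>\<^sub>\<infinity>l. \<beta> l * p (n + l))) = (\<Sum>\<^sub>\<infinity>N. (\<Sum>n\<le>N. \<beta> n * \<beta> (N - n)) * p N)"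
proof -
  let ?g = "\<lambda>(N,n). \<beta> n * \<beta> (N - n) * p N"
  have "(\<lambda>(n,l). \<beta> n * \<beta> l * p (n + l)) summable_on (UNIV \<times> UNIV) \<longleftrightarrow> ?g summable_on (Sigma UNIV (\<lambda>N. {..N}))"
    by (rule summable_on_reindex_bij_witness[of _ "\<lambda>(N,n). (n, N - n)" "\<lambda>(n,l). (n + l, n)"]) auto
  with assms have g: "?g summable_on (Sigma UNIV (\<lambda>N. {..N}))" by blast
  have "(\<Sum>\<^sub>\<infinity>n. \<beta> n * (\<Sum>\<^sub>\<infinity>l. \<beta> l * p (n + l))) = (\<Sum>\<^sub>\<infinity>n. \<Sum>\<^sub>\<infinity>l. \<beta> n * \<beta> l * p (n + l))"
    by (simp add: mult.assoc flip: infsum_cmult_right')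
  also have "\<dots> = infsum (\<lambda>(n,l). \<beta> n * \<beta> l * p (n + l)) (UNIV \<times> UNIV)"
    by (rule infsum_Sigma'_banach[OF assms])
  also have "\<dots> = infsum ?g (Sigma UNIV (\<lambda>N. {..N}))"
    by (rule infsum_reindex_bij_witness[of _ "\<lambda>(N,n). (n, N - n)" "\<lambda>(n,l). (n + l, n)"]) auto
  also have "\<dots> = (\<Sum>\<^sub>\<infinity>N. \<Sum>\<^sub>\<infinity>n\<in>{..N}. \<beta> n * \<beta> (N - n) * p N)"
    by (rule infsum_Sigma'_banach[OF g, symmetric])
  finally show ?thesis by (simp add: sum_distrib_right)
qed

text \<open>Taylor coefficients of the square root of 1 + t at t = 0.\<close>

definition sqrt_coeff :: "nat \<Rightarrow> real" where
  "sqrt_coeff n = (1/2) gchoose n"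

text \<open>The recursion (n + 1) c(n + 1) = (1/2 - n) c(n) propagates the bound, since |1/2 - n|
  \<le> n + 1. It suffices for convergence on norm below 1.\<close>

lemma sqrt_coeff_le: "\<bar>sqrt_coeff n\<bar> \<le> 1"
proof (induction n)
  case (Suc n)
  have "(1/2 - real n) * sqrt_coeff n = real (Suc n) * sqrt_coeff (Suc n)"
    using gbinomial_mult_1[of "1/2 :: real" n] by (simp add: sqrt_coeff_def algebra_simps)
  then have "real (Suc n) * \<bar>sqrt_coeff (Suc n)\<bar> = \<bar>1/2 - real n\<bar> * \<bar>sqrt_coeff n\<bar>"
    by (metis abs_mult abs_of_nat)
  also have "\<dots> \<le> real (Suc n) * 1"
    using Suc by (intro mult_mono) auto
  finally show ?case by (simp del: of_nat_Suc)
qed (simp add: sqrt_coeff_def)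

text \<open>Vandermonde's identity with 1/2 + 1/2 = 1: the square of the binomial series is 1 +
  t.\<close>

lemma sqrt_coeff_convolution:
  "(\<Sum>n\<le>N. sqrt_coeff n * sqrt_coeff (N - n)) = (if N \<le> 1 then 1 else 0)"
proof -
  have "(\<Sum>n\<le>N. sqrt_coeff n * sqrt_coeff (N - n)) = real 1 gchoose N"
    unfolding sqrt_coeff_def atMost_atLeast0 gbinomial_Vandermonde by simp
  also have "\<dots> = real (1 choose N)" by (simp only: binomial_gbinomial)
  also have "\<dots> = (if N \<le> 1 then 1 else 0)"
    by (cases "N = 0"; cases "N = 1") (auto simp: binomial_eq_0)
  finally show ?thesis .
qed

context compact_dynamics
begin

section \<open>Powers of an element and the square root of 1 + a\<close>

primrec lpow :: "'a elt \<Rightarrow> nat \<Rightarrow> 'a elt" where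
  "lpow a 0 = lone"
| "lpow a (Suc n) = a \<odot> lpow a n"

lemma lpow_l1:
  assumes "a \<in> l1space"
  shows "lpow a n \<in> l1space" "l1norm (lpow a n) \<le> l1norm a ^ n"
proof (induction n)
  case (Suc n)
  { case 1 show ?case using Suc assms by (simp add: lmult_l1) }
  { case 2
    have "l1norm (lpow a (Suc n)) \<le> l1norm a * l1norm (lpow a n)"
      using Suc assms by (simp add: lmult_l1)
    also have "\<dots> \<le> l1norm a * l1norm a ^ n"
      using Suc assms by (intro mult_left_mono l1norm_nonneg)
    finally show ?case by simp }
qed (simp_all add: lone_l1 l1norm_lone)

lemma lpow_add: "a \<in> l1space \<Longrightarrow> lpow a (m + n) = lpow a m \<odot> lpow a n"
  by (induction m) (simp_all add: lone_lmult lmult_assoc lpow_l1)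

lemma lstar_lpow: 
  assumes "a \<in> l1space" "adj a = a" shows "adj (lpow a n) = lpow a n"
proof (induction n)
  case (Suc n)
  have "adj (lpow a (Suc n)) = lpow a n \<odot> lpow a 1"
    using Suc assms by (simp add: lstar_lmult lmult_lone)
  also have "\<dots> = lpow a (Suc n)" using lpow_add[OF assms(1), of n 1] by simp
  finally show ?case .
qed (simp add: lstar_lone)

definition lsqrt1 :: "'a elt \<Rightarrow> 'a elt" where
  "lsqrt1 a = series (\<lambda>n. lscale (of_real (sqrt_coeff n)) (lpow a n))"

text \<open>Self-adjointness holds because the coefficients are real and the powers of a are
  self-adjoint. For the square, all products of powers depend only on the total exponent, so the
  Cauchy product reduces it to \<open>sqrt_coeff_convolution\<close>.\<close>

lemma lsqrt1:
  assumes "a \<in> l1space" "adj a = a" "l1norm a < 1"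
  shows "lsqrt1 a \<in> l1space" "adj (lsqrt1 a) = lsqrt1 a" "lsqrt1 a \<odot> lsqrt1 a = ladd lone a"
proof -
  define \<beta> where "\<beta> n = complex_of_real (sqrt_coeff n)" for n
  define u where "u = (\<lambda>n. lscale (\<beta> n) (lpow a n))"
  have c: "lsqrt1 a = series u" by (simp add: lsqrt1_def u_def \<beta>_def)
  have b1: "cmod (\<beta> n) \<le> 1" for n using sqrt_coeff_le by (simp add: \<beta>_def)
  have u1: "u n \<in> l1space" for n using lpow_l1[OF assms(1)] by (simp add: u_def lscale_l1)
  have q0: "0 \<le> l1norm a" using assms by (simp add: l1norm_nonneg)
  have geo: "(\<lambda>n. l1norm a ^ n) summable_on UNIV"
    using assms(3) q0 by (auto intro!: summable_nonneg_imp_summable_on)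
  have un: "l1norm (u n) \<le> l1norm a ^ n" for n
  proof -
    have "l1norm (u n) \<le> cmod (\<beta> n) * l1norm (lpow a n)"
      using lpow_l1[OF assms(1)] by (simp add: u_def lscale_l1)
    also have "\<dots> \<le> 1 * l1norm a ^ n"
      by (intro mult_mono b1 lpow_l1 assms l1norm_nonneg) auto
    finally show ?thesis by simp
  qed
  have u2: "(\<lambda>n. l1norm (u n)) summable_on UNIV"
    by (rule summable_on_comparison_test[OF geo]) (use un u1 in \<open>auto intro: l1norm_nonneg\<close>)
  show c1: "lsqrt1 a \<in> l1space" unfolding c by (rule series_l1[OF u1 u2])
  have "adj (u n) = u n" for n
    using lstar_lpow[OF assms(1,2)] by (simp add: u_def lstar_lscale \<beta>_def)
  then have "cnj (u n (- k) (s (- k) x)) = u n k x" for n k x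
    by (metis lstar_apply)
  then show "adj (lsqrt1 a) = lsqrt1 a"
    unfolding c by (intro ext) (simp add: lstar_def series_def flip: infsum_cnj)
  show "lsqrt1 a \<odot> lsqrt1 a = ladd lone a"
  proof (intro ext)
    fix m x
    have "(series u \<odot> u n) m x = \<beta> n * (\<Sum>\<^sub>\<infinity>l. \<beta> l * lpow a (n + l) m x)" for n
    proof -
      have "(series u \<odot> u n) m x = \<beta> n * (series u \<odot> lpow a n) m x"
        by (simp add: u_def lmult_lscale_right) (simp add: lscale_def)
      also have "(series u \<odot> lpow a n) m x = (\<Sum>\<^sub>\<infinity>l. (u l \<odot> lpow a n) m x)"
        by (rule lmult_series_left[OF lpow_l1(1)[OF assms(1)] u1 u2])
      also have "\<dots> = (\<Sum>\<^sub>\<infinity>l. \<beta> l * lpow a (n + l) m x)"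
        by (simp add: u_def lmult_lscale_left add.commute[of n] lpow_add[OF assms(1)])
           (simp add: lscale_def)
      finally show ?thesis .
    qed
    then have "(series u \<odot> series u) m x = (\<Sum>\<^sub>\<infinity>n. \<beta> n * (\<Sum>\<^sub>\<infinity>l. \<beta> l * lpow a (n + l) m x))"
      using lmult_series_right[OF c1[unfolded c] u1 u2] by simp
    also have "\<dots> = (\<Sum>\<^sub>\<infinity>N. (\<Sum>n\<le>N. \<beta> n * \<beta> (N - n)) * lpow a N m x)"
    proof (rule infsum_nat_pairs_by_sum, rule complex_summable_comparison(1))
      show "(\<lambda>(n,l). l1norm a ^ n * l1norm a ^ l) summable_on UNIV \<times> UNIV"
        by (rule has_sum_imp_summable[OF has_sum_product_pairs[OF geo geo]]) (use q0 in auto)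
      have "cmod (\<beta> n * \<beta> l * lpow a (n + l) m x) \<le> 1 * 1 * l1norm a ^ (n + l)" for n l
        unfolding norm_mult
        using order_trans[OF cmod_le_l1norm lpow_l1(2)] lpow_l1(1) assms(1) b1
        by (intro mult_mono) auto
      then show "cmod (case p of (n,l) \<Rightarrow> \<beta> n * \<beta> l * lpow a (n + l) m x)
          \<le> (case p of (n,l) \<Rightarrow> l1norm a ^ n * l1norm a ^ l)" for p
        by (auto simp: power_add split: prod.split)
    qed
    also have "\<dots> = (\<Sum>\<^sub>\<infinity>N. (if N \<le> 1 then 1 else 0) * lpow a N m x)"
    proof -
      have "(\<Sum>n\<le>N. \<beta> n * \<beta> (N - n)) = (if N \<le> 1 then 1 else 0)" for N
        using arg_cong[OF sqrt_coeff_convolution[of N], of complex_of_real]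
        by (simp add: \<beta>_def split: if_splits)
      thus ?thesis by simp
    qed
    also have "\<dots> = (\<Sum>\<^sub>\<infinity>N\<in>{0,1}. lpow a N m x)"
      by (rule infsum_cong_neutral) auto
    also have "\<dots> = ladd lone a m x"
      by (simp add: ladd_def lmult_lone)
    finally show "(lsqrt1 a \<odot> lsqrt1 a) m x = ladd lone a m x" by (simp add: c)
  qed
qed

end

subsection \<open>The commutant and positive functionals\<close>

text \<open>The values t = 1, -1, \<i> force v to be the conjugate of u and q to be nonnegative.
  Taking t = -r cnj u with r = 1 / (q + 1) then gives |u|^2 r (r q - 2), which is negative unless u
  = 0.\<close>

lemma nonneg_quadratic_imp_zero:
  assumes nn: "\<And>t. nonneg (t * u + cnj t * v + t * cnj t * q)"
  shows "u = 0 \<and> v = 0"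
proof -
  have q: "Im q = 0" "0 \<le> Re q" and uv: "Im u + Im v = 0"
    using nn[of 1] nn[of "-1"] by (auto simp: nonneg_def)
  have "Re u - Re v = 0"
    using nn[of \<i>] q by (auto simp: nonneg_def)
  with uv have v: "v = cnj u" by (simp add: complex_eq_iff)
  define r where "r = 1 / (Re q + 1)"
  have r: "r > 0" "r * Re q < 1" using q by (auto simp: r_def)
  have "0 \<le> Re (- of_real r * cnj u * u + cnj (- of_real r * cnj u) * v
      + (- of_real r * cnj u) * cnj (- of_real r * cnj u) * q)"
    using nn[of "- of_real r * cnj u"] by (simp only: nonneg_def)
  also have "\<dots> = ((Re u)\<^sup>2 + (Im u)\<^sup>2) * (r * (r * Re q - 2))"
    using q unfolding v by (simp add: power2_eq_square algebra_simps)
  finally have "0 \<le> ((Re u)\<^sup>2 + (Im u)\<^sup>2) * (r * (r * Re q - 2))" .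
  moreover have "r * (r * Re q - 2) < 0" using r by (simp add: mult_pos_neg)
  ultimately have "(Re u)\<^sup>2 + (Im u)\<^sup>2 \<le> 0"
    by (smt (verit) mult_pos_neg)
  then have "u = 0" by (simp add: complex_eq_iff sum_power2_le_zero_iff)
  with v show ?thesis by simp
qed

context compact_dynamics
begin

section \<open>Urysohn functions and interiors of the fixed-point sets\<close>

lemma normal_space_UNIV: "normal_space (euclidean :: 'a topology)"
proof (rule compact_Hausdorff_or_regular_imp_normal_space)
  show "compact_space (euclidean :: 'a topology)"
    using compact_UNIV by (simp add: compact_space_def)
  have "Hausdorff_space (euclidean :: 'a topology)"
    unfolding Hausdorff_space_def disjnt_def using hausdorff by simp blast
  then show "Hausdorff_space (euclidean :: 'a topology) \<or> regular_space (euclidean :: 'a topology)" ..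
qed

lemma bump_function:
  fixes x :: 'a
  assumes "open U" "x \<in> U"
  obtains f :: "'a \<Rightarrow> complex" where "contfun f" "f x = 1" "\<And>y. y \<notin> U \<Longrightarrow> f y = 0"
proof -
  have "closedin euclidean (- U)" "closedin euclidean {x}" "disjnt (- U) {x}"
    using assms by (auto simp: disjnt_def closed_Compl)
  then obtain g :: "'a \<Rightarrow> real" where g: "continuous_map euclidean euclideanreal g" "g ` (- U) \<subseteq> {0}" "g ` {x} \<subseteq> {1}"
    using Urysohn_lemma_alt[OF normal_space_UNIV] by metis
  show ?thesis
  proof (rule that[of "\<lambda>y. of_real (g y)"])
    show "contfun (\<lambda>y. complex_of_real (g y))"
      using g(1) by (auto simp: contfun_def intro!: continuous_intros)
  qed (use g in auto)
qed

abbreviation FixI :: "int \<Rightarrow> 'a set" where "FixI k \<equiv> interior (Fix \<sigma> k)"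

lemma mem_Fix: "x \<in> Fix \<sigma> k \<longleftrightarrow> s k x = x"
  by (simp add: Fix_def)

lemma FixI_imp: "x \<in> FixI k \<Longrightarrow> s k x = x"
  using interior_subset mem_Fix by blast

lemma sigpow_minus_fixed: "s (- k) x = x \<longleftrightarrow> s k x = x"
  by (metis sigpow_inverse)

lemma FixI_0: "x \<in> FixI 0"
proof -
  have "Fix \<sigma> 0 = UNIV" by (auto simp: mem_Fix)
  thus ?thesis by simp
qed

lemma FixI_minus: "FixI (- k) = FixI k"
proof -
  have "Fix \<sigma> (- k) = Fix \<sigma> k" by (auto simp: mem_Fix sigpow_minus_fixed)
  thus ?thesis by simp
qed

text \<open>Together with \<open>FixI_0\<close> and \<open>FixI_minus\<close> this makes the
  integers n with x in \<open>FixI n\<close> a subgroup.\<close>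

lemma FixI_add:
  assumes "x \<in> FixI j" "x \<in> FixI k" shows "x \<in> FixI (j + k)"
proof -
  have "FixI j \<inter> FixI k \<subseteq> Fix \<sigma> (j + k)"
    by (auto simp: mem_Fix sigpow_add dest!: FixI_imp)
  then have "FixI j \<inter> FixI k \<subseteq> FixI (j + k)"
    by (intro interior_maximal) auto
  with assms show ?thesis by blast
qed

lemma FixI_diff: "x \<in> FixI j \<Longrightarrow> x \<in> FixI k \<Longrightarrow> x \<in> FixI (j - k)"
  using FixI_add[of x j "- k"] by (simp add: FixI_minus)

lemma FixI_diff_iff: "x \<in> FixI k \<Longrightarrow> x \<in> FixI (n - k) \<longleftrightarrow> x \<in> FixI n"
  using FixI_add[of x "n - k" k] FixI_diff[of x n k] by auto

text \<open>The preimage of \<open>FixI k\<close> under \<open>s m\<close> is open, and it lies in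
  \<open>Fix \<sigma> k\<close> because powers of \<sigma> commute.\<close>

lemma FixI_sigpow_imp:
  assumes "s m x \<in> FixI k" shows "x \<in> FixI k"
proof -
  have "open (s m -` FixI k)"
    using continuous_sigpow by (simp add: open_vimage)
  moreover have "s m -` FixI k \<subseteq> Fix \<sigma> k"
  proof
    fix y assume "y \<in> s m -` FixI k"
    then have "s k (s m y) = s m y" by (auto dest: FixI_imp)
    then have "s (- m) (s m (s k y)) = s (- m) (s m y)" by (simp only: sigpow_commute[of m k])
    then show "y \<in> Fix \<sigma> k" by (simp add: mem_Fix)
  qed
  ultimately have "s m -` FixI k \<subseteq> FixI k" by (rule interior_maximal[rotated])
  with assms show ?thesis by blast
qed

lemma FixI_sigpow: "s m x \<in> FixI k \<longleftrightarrow> x \<in> FixI k"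
  using FixI_sigpow_imp[of m x k] FixI_sigpow_imp[of "- m" "s m x" k] by auto

text \<open>Commuting with f means that f(x) and f(\<open>s (- k) x\<close>) agree wherever
  \<open>a k x\<close> is nonzero, and continuous functions separate points.\<close>

lemma comm1_iff: "a \<in> comm1 \<sigma> \<longleftrightarrow> a \<in> l1space \<and> (\<forall>k x. a k x \<noteq> 0 \<longrightarrow> s k x = x)"
proof (intro iffI conjI allI impI)
  assume a: "a \<in> comm1 \<sigma>"
  then show "a \<in> l1space" by (simp add: comm1_def)
  fix k x assume nz: "a k x \<noteq> 0"
  have eq: "f x * a k x = a k x * f (s (- k) x)" if "contfun f" for f
  proof -
    have "emb f \<odot> a = a \<odot> emb f" using a that by (simp add: comm1_def)
    then have "(emb f \<odot> a) k x = (a \<odot> emb f) k x" by simp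
    then show ?thesis by (simp only: emb_lmult lmult_emb)
  qed
  have "s (- k) x = x"
  proof (rule ccontr)
    assume "s (- k) x \<noteq> x"
    then obtain f :: "'a \<Rightarrow> complex" where f: "contfun f" "f x = 1" "f (s (- k) x) = 0"
      using bump_function[of "- {s (- k) x}" x] by auto
    with eq[OF f(1)] nz show False by simp
  qed
  then show "s k x = x" by (simp add: sigpow_minus_fixed)
next
  assume a: "a \<in> l1space \<and> (\<forall>k x. a k x \<noteq> 0 \<longrightarrow> s k x = x)"
  have "emb f \<odot> a = a \<odot> emb f" for f
  proof (intro ext)
    fix k x
    show "(emb f \<odot> a) k x = (a \<odot> emb f) k x"
      using a by (cases "a k x = 0") (auto simp: emb_lmult lmult_emb sigpow_minus_fixed[THEN iffD2])
  qed
  with a show "a \<in> comm1 \<sigma>" by (simp add: comm1_def)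
qed

lemma comm1_l1: "a \<in> comm1 \<sigma> \<Longrightarrow> a \<in> l1space"
  by (simp add: comm1_def)

lemma comm1_fixed: "a \<in> comm1 \<sigma> \<Longrightarrow> a k x \<noteq> 0 \<Longrightarrow> s k x = x"
  by (simp add: comm1_iff)

text \<open>The set where a continuous coefficient is nonzero is open, so it lies in the
  interior.\<close>

lemma comm1_support:
  assumes "a \<in> comm1 \<sigma>" "a k x \<noteq> 0" shows "x \<in> FixI k"
proof -
  have "continuous_on UNIV (a k)"
    using l1_contfun[OF comm1_l1[OF assms(1)]] by (simp add: contfun_def)
  then have "open {y. a k y \<noteq> 0}"
    by (intro open_Collect_neq continuous_intros)
  moreover have "{y. a k y \<noteq> 0} \<subseteq> Fix \<sigma> k"
    using comm1_fixed[OF assms(1)] by (auto simp: mem_Fix)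
  ultimately have "{y. a k y \<noteq> 0} \<subseteq> FixI k" by (rule interior_maximal[rotated])
  with assms show ?thesis by blast
qed

lemma comm1_lmult:
  assumes "a \<in> comm1 \<sigma>" "b \<in> comm1 \<sigma>" shows "a \<odot> b \<in> comm1 \<sigma>"
  unfolding comm1_iff
proof (intro conjI allI impI)
  show "a \<odot> b \<in> l1space" using assms by (simp add: comm1_l1 lmult_l1)
  fix n x assume "(a \<odot> b) n x \<noteq> 0"
  then obtain k where "a k x * b (n - k) (s (- k) x) \<noteq> 0"
    unfolding lmult_def by (metis (mono_tags, lifting) infsum_0)
  then have k: "s k x = x" "s (n - k) (s (- k) x) = s (- k) x"
    using assms comm1_fixed by auto
  then have "s (n - k) x = x" by (simp add: sigpow_minus_fixed[THEN iffD2])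
  with k(1) show "s n x = x" using sigpow_add[of "n - k" k x] by simp
qed

text \<open>The twist in the involution disappears: either x is fixed by \<open>s n\<close>, or the
  coefficient vanishes both at x and at \<open>s (- n) x\<close>.\<close>

lemma comm1_lstar_apply:
  assumes "a \<in> comm1 \<sigma>" shows "adj a n x = cnj (a (- n) x)"
proof (cases "s n x = x")
  case False
  have "s (- n) x \<noteq> x" using False by (simp add: sigpow_minus_fixed)
  moreover have "s (- n) (s (- n) x) \<noteq> s (- n) x" using False by (metis sigpow_inverse(2))
  ultimately have "a (- n) x = 0" "a (- n) (s (- n) x) = 0"
    using comm1_fixed[OF assms] by blast+
  then show ?thesis by (simp add: lstar_def)
qed (simp add: lstar_def sigpow_minus_fixed[THEN iffD2])

lemma comm1_lstar: "a \<in> comm1 \<sigma> \<Longrightarrow> adj a \<in> comm1 \<sigma>"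
  unfolding comm1_iff[of "adj a"]
  by (auto simp: comm1_l1 lstar_l1 comm1_lstar_apply sigpow_minus_fixed dest!: comm1_fixed[of a])

lemma comm1_ladd: "a \<in> comm1 \<sigma> \<Longrightarrow> b \<in> comm1 \<sigma> \<Longrightarrow> ladd a b \<in> comm1 \<sigma>"
  unfolding comm1_iff by (simp add: ladd_l1) (metis ladd_def add_0)

lemma comm1_lscale: "a \<in> comm1 \<sigma> \<Longrightarrow> lscale c a \<in> comm1 \<sigma>"
  by (auto simp: comm1_iff lscale_l1) (auto simp: lscale_def)

lemma comm1_emb: "contfun f \<Longrightarrow> emb f \<in> comm1 \<sigma>"
  by (auto simp: comm1_iff emb_l1) (auto simp: emb_def split: if_splits)

lemma comm1_lone: "lone \<in> comm1 \<sigma>"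
  by (simp add: lone_def comm1_emb contfun_const)

lemma comm1_lsqrt1:
  assumes "a \<in> comm1 \<sigma>" "adj a = a" "l1norm a < 1"
  shows "lsqrt1 a \<in> comm1 \<sigma>"
  unfolding comm1_iff
proof (intro conjI allI impI)
  show "lsqrt1 a \<in> l1space" using assms by (intro lsqrt1 comm1_l1)
  have pow: "lpow a n \<in> comm1 \<sigma>" for n
    by (induction n) (simp_all add: comm1_lone comm1_lmult assms)
  fix k x assume "lsqrt1 a k x \<noteq> 0"
  then obtain n where "lscale (of_real (sqrt_coeff n)) (lpow a n) k x \<noteq> 0"
    unfolding lsqrt1_def series_def by (metis (mono_tags, lifting) infsum_0)
  then show "s k x = x" using comm1_fixed[OF pow] by (auto simp: lscale_def)
qed

text \<open>The domain is a parameter so that one boundedness argument serves both states of the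
  commutant and their compositions with a projection on all of \<open>l1space\<close>.\<close>

definition positive_functional :: "'a elt set \<Rightarrow> ('a elt \<Rightarrow> complex) \<Rightarrow> bool" where
  "positive_functional B \<phi> \<longleftrightarrow>
     (\<forall>a\<in>B. \<forall>b\<in>B. \<phi> (ladd a b) = \<phi> a + \<phi> b) \<and>
     (\<forall>a\<in>B. \<forall>c. \<phi> (lscale c a) = c * \<phi> a) \<and>
     (\<forall>a\<in>B. nonneg (\<phi> (adj a \<odot> a))) \<and>
     \<phi> lone = 1"

lemma is_state_iff: "is_state \<sigma> \<phi> \<longleftrightarrow> positive_functional (comm1 \<sigma>) \<phi>"
  by (simp add: is_state_def positive_functional_def)

text \<open>If |r| times the norm of a is below 1, then 1 + r a is the square of a self-adjoint
  element of B, so 1 + r \<phi>(a) is nonnegative. Use r = 1/t and r = -1/t, and let t decrease to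
  the norm.\<close>

lemma positive_functional_selfadjoint:
  assumes \<phi>: "positive_functional B \<phi>" and B: "B = l1space \<or> B = comm1 \<sigma>"
    and a: "a \<in> B" "adj a = a"
  shows "cmod (\<phi> a) \<le> l1norm a"
proof -
  have a1: "a \<in> l1space" using a(1) B comm1_l1 by auto
  have key: "nonneg (1 + of_real r * \<phi> a)" if r: "\<bar>r\<bar> * l1norm a < 1" for r
  proof -
    let ?b = "lscale (of_real r) a"
    have b: "?b \<in> B" "?b \<in> l1space" "lone \<in> B"
      using a(1) B by (auto simp: lscale_l1 comm1_lscale comm1_l1 lone_l1 comm1_lone)
    have adj: "adj ?b = ?b" by (simp add: lstar_lscale a)
    have nm: "l1norm ?b < 1" using lscale_l1(2)[OF a1, of "of_real r"] r by simp
    have "lsqrt1 ?b \<in> B" using B b adj nm lsqrt1(1) comm1_lsqrt1 by auto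
    then have "nonneg (\<phi> (ladd lone ?b))"
      using \<phi> lsqrt1(2,3)[OF b(2) adj nm] unfolding positive_functional_def by metis
    then show ?thesis using \<phi> b a(1) by (simp add: positive_functional_def)
  qed
  have bound: "cmod (\<phi> a) \<le> t" if t: "l1norm a < t" for t
  proof -
    have t0: "t > 0" using t l1norm_nonneg[OF a1] by linarith
    have "nonneg (1 + of_real (1/t) * \<phi> a)" "nonneg (1 + of_real (- (1/t)) * \<phi> a)"
      by (rule key; use t t0 in \<open>simp add: field_simps\<close>)+
    then have "Im (\<phi> a) = 0" "\<bar>Re (\<phi> a)\<bar> \<le> t"
      using t0 by (auto simp: nonneg_def field_simps)
    then show ?thesis by (simp add: cmod_eq_Re)
  qed
  show ?thesis by (rule dense_ge) (use bound in auto)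
qed

lemma positive_functional_bound:
  assumes \<phi>: "positive_functional B \<phi>" and B: "B = l1space \<or> B = comm1 \<sigma>" and a: "a \<in> B"
  shows "cmod (\<phi> a) \<le> 2 * l1norm a"
proof -
  have a1: "a \<in> l1space" using a B comm1_l1 by auto
  \<comment> \<open>Real and imaginary parts of a; each has norm at most that of a, whence the
    constant 2.\<close>
  define h where "h = lscale (1/2) (ladd a (adj a))"
  define k where "k = lscale (-\<i>/2) (ladd a (lscale (-1) (adj a)))"
  have mem: "h \<in> B" "k \<in> B" "lscale \<i> k \<in> B"
    using B a a1 unfolding h_def k_def
    by (auto intro!: lscale_l1 ladd_l1 lstar_l1 comm1_lscale comm1_ladd comm1_lstar)
  have adj: "adj h = h" "adj k = k"
    by (auto simp: h_def k_def lstar_lscale lstar_ladd lstar_lstar)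
       (auto simp: lscale_def ladd_def algebra_simps)
  have dec: "a = ladd h (lscale \<i> k)"
    by (intro ext) (simp add: h_def k_def lscale_def ladd_def field_simps)
  have adja: "adj a \<in> l1space" "l1norm (adj a) \<le> l1norm a" using lstar_l1[OF a1] by auto
  have "l1norm h \<le> 1/2 * l1norm (ladd a (adj a))"
    unfolding h_def using lscale_l1(2)[OF ladd_l1(1)[OF a1 adja(1)], of "1/2"] by simp
  also have "\<dots> \<le> l1norm a" using ladd_l1(2)[OF a1 adja(1)] adja by simp
  finally have h: "l1norm h \<le> l1norm a" .
  have m: "lscale (-1) (adj a) \<in> l1space" "l1norm (lscale (-1) (adj a)) \<le> l1norm (adj a)"
    using lscale_l1[OF adja(1), of "-1"] by auto
  have "l1norm k \<le> 1/2 * l1norm (ladd a (lscale (-1) (adj a)))"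
    unfolding k_def using lscale_l1(2)[OF ladd_l1(1)[OF a1 m(1)], of "-\<i>/2"] by simp
  also have "\<dots> \<le> l1norm a" using ladd_l1(2)[OF a1 m(1)] adja m by simp
  finally have k: "l1norm k \<le> l1norm a" .
  have "\<phi> a = \<phi> h + \<i> * \<phi> k"
    using \<phi> mem unfolding positive_functional_def by (metis dec)
  then have "cmod (\<phi> a) \<le> cmod (\<phi> h) + cmod (\<phi> k)"
    by (metis norm_triangle_ineq norm_mult norm_ii mult_1)
  also have "\<dots> \<le> 2 * l1norm a"
    using positive_functional_selfadjoint[OF \<phi> B mem(1) adj(1)]
      positive_functional_selfadjoint[OF \<phi> B mem(2) adj(2)] h k by linarith
  finally show ?thesis .
qed

text \<open>The degenerate case of Cauchy-Schwarz: the value of \<psi> at the square of h + t a is a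
  quadratic in t without constant term.\<close>

lemma positive_functional_degenerate:
  assumes \<psi>: "positive_functional l1space \<psi>" and h: "h \<in> l1space" "\<psi> (adj h \<odot> h) = 0"
    and a: "a \<in> l1space"
  shows "\<psi> (adj h \<odot> a) = 0 \<and> \<psi> (adj a \<odot> h) = 0"
proof (rule nonneg_quadratic_imp_zero)
  fix t
  let ?b = "ladd h (lscale t a)"
  note [simp] = lscale_l1(1) ladd_l1(1) lstar_l1(1) lmult_l1(1) h(1) a
  have add: "\<psi> (ladd c d) = \<psi> c + \<psi> d" if "c \<in> l1space" "d \<in> l1space" for c d
    using \<psi> that by (simp add: positive_functional_def)
  have scale: "\<psi> (lscale r c) = r * \<psi> c" if "c \<in> l1space" for c r
    using \<psi> that by (simp add: positive_functional_def)
  have "\<psi> (adj ?b \<odot> ?b) = t * \<psi> (adj h \<odot> a) + cnj t * \<psi> (adj a \<odot> h) + t * cnj t * \<psi> (adj a \<odot> a)"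
    by (simp add: lstar_ladd lstar_lscale lmult_ladd_left lmult_ladd_right lmult_lscale_left
        lmult_lscale_right add scale h(2) algebra_simps)
  moreover have "nonneg (\<psi> (adj ?b \<odot> ?b))"
    using \<psi> by (simp add: positive_functional_def)
  ultimately show "nonneg (t * \<psi> (adj h \<odot> a) + cnj t * \<psi> (adj a \<odot> h) + t * cnj t * \<psi> (adj a \<odot> a))"
    by simp
qed

end

subsection \<open>Positive projections\<close>

text \<open>For a in the commutant and c(k) = \<open>a k x\<close>, the number T(n) is the
  coefficient of \<open>adj a \<odot> a\<close> at n and x. The bound uses 2|uv| \<le> |u|^2 + |v|^2
  and invariance of the sum under shifts.\<close>

lemma autocorrelation:
  fixes c :: "int \<Rightarrow> complex"
  defines "T \<equiv> \<lambda>n. \<Sum>\<^sub>\<infinity>k. cnj (c k) * c (n + k)"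
  assumes sm: "(\<lambda>k. (cmod (c k))\<^sup>2) summable_on UNIV"
  shows "T 0 = of_real (\<Sum>\<^sub>\<infinity>k. (cmod (c k))\<^sup>2)"
    and "T (- n) = cnj (T n)"
    and "cmod (T n) \<le> (\<Sum>\<^sub>\<infinity>k. (cmod (c k))\<^sup>2)"
proof -
  have "T 0 = (\<Sum>\<^sub>\<infinity>k. of_real ((cmod (c k))\<^sup>2))"
    unfolding T_def by (intro infsum_cong) (metis add_0 complex_norm_square mult.commute)
  also have "\<dots> = of_real (\<Sum>\<^sub>\<infinity>k. (cmod (c k))\<^sup>2)"
    by (rule infsumI, rule has_sum_of_real) (use sm in simp)
  finally show "T 0 = of_real (\<Sum>\<^sub>\<infinity>k. (cmod (c k))\<^sup>2)" .
  have "T (- n) = (\<Sum>\<^sub>\<infinity>k. cnj (c (k + n)) * c (- n + (k + n)))"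
    unfolding T_def by (rule infsum_int_shift[of "\<lambda>k. cnj (c k) * c (- n + k)" n, symmetric])
  also have "\<dots> = cnj (T n)"
    unfolding T_def by (simp add: add.commute mult.commute flip: infsum_cnj)
  finally show "T (- n) = cnj (T n)" .
  let ?S = "\<Sum>\<^sub>\<infinity>k. (cmod (c k))\<^sup>2"
  have sm': "(\<lambda>k. (cmod (c (k + n)))\<^sup>2) summable_on UNIV"
    using sm by (subst summable_on_reindex_bij_witness[of _ "\<lambda>k. k - n" "\<lambda>k. k + n" UNIV "\<lambda>k. (cmod (c k))\<^sup>2"]) auto
  have "((\<lambda>k. 1/2 * ((cmod (c k))\<^sup>2 + (cmod (c (k + n)))\<^sup>2)) has_sum 1/2 * (?S + (\<Sum>\<^sub>\<infinity>k. (cmod (c (k + n)))\<^sup>2))) UNIV"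
    by (intro has_sum_cmult_right has_sum_add has_sum_infsum sm sm')
  also have "(\<Sum>\<^sub>\<infinity>k. (cmod (c (k + n)))\<^sup>2) = ?S"
    by (rule infsum_int_shift)
  finally have hs: "((\<lambda>k. 1/2 * ((cmod (c k))\<^sup>2 + (cmod (c (k + n)))\<^sup>2)) has_sum ?S) UNIV" by simp
  have le: "cmod (cnj (c k) * c (n + k)) \<le> 1/2 * ((cmod (c k))\<^sup>2 + (cmod (c (k + n)))\<^sup>2)" for k
    using sum_squares_bound[of "cmod (c k)" "cmod (c (k + n))"] by (simp add: norm_mult add.commute)
  show "cmod (T n) \<le> ?S"
    unfolding T_def
    using complex_summable_comparison(2)[OF has_sum_imp_summable[OF hs] le] unfolding infsumI[OF hs] .
qed

context compact_dynamics
begin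

section \<open>Truncations and states supported at a point\<close>

definition restr :: "int set \<Rightarrow> 'a elt \<Rightarrow> 'a elt" where
  "restr K a = (\<lambda>k. if k \<in> K then a k else (\<lambda>x. 0))"

lemma restr_l1:
  assumes "a \<in> l1space" shows "restr K a \<in> l1space" "l1norm (restr K a) \<le> l1norm a"
proof -
  have 1: "contfun (restr K a n)" for n
    using l1_contfun[OF assms] by (simp add: restr_def contfun_const)
  have 2: "cmod (restr K a n x) \<le> supnorm (a n)" for n x
    using l1_cmod_le[OF assms] l1_supnorm_nonneg[OF assms] by (simp add: restr_def)
  show "restr K a \<in> l1space" "l1norm (restr K a) \<le> l1norm a"
    using l1I[OF 1 2 l1_summable[OF assms]] by (auto simp: l1norm_def)
qed

lemma restr_split: "a = ladd (restr K a) (restr (- K) a)"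
  by (intro ext) (simp add: restr_def ladd_def)

text \<open>Density of finite sums: the norm of the tail is at most the remainder of the convergent
  sum of sup norms.\<close>

lemma restr_tail_small:
  assumes "a \<in> l1space" "0 < e"
  obtains K where "finite K" "l1norm (restr (- K) a) \<le> e"
proof -
  let ?f = "\<lambda>k. supnorm (a k)"
  obtain K where K: "finite K" "dist (sum ?f K) (infsum ?f UNIV) \<le> e"
    using infsum_finite_approximation[OF l1_summable[OF assms(1)] assms(2)] by auto
  let ?M = "\<lambda>k. if k \<in> K then 0 else ?f k"
  have sub: "?f summable_on UNIV - K" "?f summable_on UNIV" "?f summable_on K"
    using l1_summable[OF assms(1)] K(1) summable_on_subset[of ?f UNIV "UNIV - K"] by auto
  have eq: "(?M has_sum S) UNIV \<longleftrightarrow> (?f has_sum S) (UNIV - K)" for S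
    by (rule has_sum_cong_neutral) auto
  have 1: "contfun (restr (- K) a n)" for n
    using l1_contfun[OF assms(1)] by (simp add: restr_def contfun_const)
  have 2: "cmod (restr (- K) a n x) \<le> ?M n" for n x
    using l1_cmod_le[OF assms(1)] by (simp add: restr_def)
  have "infsum ?M UNIV = infsum ?f (UNIV - K)"
    using eq sub(1) by (metis (no_types, lifting) has_sum_infsum infsumI)
  also have "\<dots> = infsum ?f UNIV - sum ?f K"
    using infsum_Diff[OF sub(2,3)] K(1) by simp
  also have "\<dots> \<le> e" using K(2) by (simp add: dist_real_def)
  finally have "infsum ?M UNIV \<le> e" .
  moreover have "?M summable_on UNIV"
    using eq sub(1) by (auto simp: summable_on_def)
  ultimately show ?thesis
    using that[OF K(1)] l1I(2)[OF 1 2] by force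
qed

lemma lstar_lmult_self: "(adj a \<odot> a) n x = (\<Sum>\<^sub>\<infinity>k. cnj (a k (s k x)) * a (n + k) (s k x))"
  unfolding lmult_def lstar_def
  by (subst infsum_int_minus[symmetric]) simp

lemma comm1_lstar_lmult_self:
  assumes "a \<in> comm1 \<sigma>"
  shows "(adj a \<odot> a) n x = (\<Sum>\<^sub>\<infinity>k. cnj (a k x) * a (n + k) x)"
proof -
  have "cnj (a k (s k x)) * a (n + k) (s k x) = cnj (a k x) * a (n + k) x" for k
  proof (cases "s k x = x")
    case False
    moreover have "s k (s k x) \<noteq> s k x" using False by (metis sigpow_inverse(1))
    ultimately have "a k x = 0" "a k (s k x) = 0" using comm1_fixed[OF assms] by blast+
    then show ?thesis by simp
  qed simp
  then show ?thesis by (simp add: lstar_lmult_self)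
qed

text \<open>On a square in the commutant the value is T(0) + Re(cnj w T(n)) with T as in
  \<open>autocorrelation\<close>; this is nonnegative for |w| \<le> 1. The choice n \<noteq> 0
  secures the value 1 at the unit.\<close>

definition point_state :: "'a \<Rightarrow> int \<Rightarrow> complex \<Rightarrow> 'a elt \<Rightarrow> complex" where
  "point_state x n w a = a 0 x + (cnj w * a n x + w * a (- n) x) / 2"

lemma l1_square_summable:
  fixes a :: "'a elt"
  assumes "a \<in> l1space" shows "(\<lambda>k. (cmod (a k (y k)))\<^sup>2) summable_on UNIV"
proof (rule summable_on_comparison_test)
  show "(\<lambda>k. l1norm a * supnorm (a k)) summable_on UNIV"
    by (intro summable_on_cmult_right l1_summable assms)
  show "(cmod (a k (y k)))\<^sup>2 \<le> l1norm a * supnorm (a k)" for k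
    unfolding power2_eq_square
    by (intro mult_mono cmod_le_l1norm l1_cmod_le l1norm_nonneg assms) auto
qed auto

lemma point_state:
  assumes "n \<noteq> 0" "cmod w \<le> 1"
  shows "is_state \<sigma> (point_state x n w)"
  unfolding is_state_def
proof (intro conjI ballI allI)
  fix a b c assume "a \<in> comm1 \<sigma>"
  show "point_state x n w (ladd a b) = point_state x n w a + point_state x n w b"
    by (simp add: point_state_def ladd_def algebra_simps add_divide_distrib)
  show "point_state x n w (lscale c a) = c * point_state x n w a"
    by (simp add: point_state_def lscale_def algebra_simps)
next
  fix a assume a: "a \<in> comm1 \<sigma>"
  define T where "T m = (\<Sum>\<^sub>\<infinity>k. cnj (a k x) * a (m + k) x)" for m
  define S where "S = (\<Sum>\<^sub>\<infinity>k. (cmod (a k x))\<^sup>2)"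
  note ac = autocorrelation[of "\<lambda>k. a k x", OF l1_square_summable[OF comm1_l1[OF a]], folded T_def S_def]
  have "point_state x n w (adj a \<odot> a) = T 0 + (cnj w * T n + w * T (- n)) / 2"
    by (simp add: point_state_def comm1_lstar_lmult_self[OF a] T_def)
  also have "\<dots> = of_real S + (cnj w * T n + cnj (cnj w * T n)) / 2"
    by (simp add: ac)
  also have "\<dots> = of_real (S + Re (cnj w * T n))"
    by (subst complex_add_cnj) simp
  finally have eq: "point_state x n w (adj a \<odot> a) = of_real (S + Re (cnj w * T n))" .
  have "cmod (cnj w * T n) \<le> 1 * S"
    unfolding norm_mult using assms ac(3)[of n] by (intro mult_mono) auto
  then have "0 \<le> S + Re (cnj w * T n)" using abs_Re_le_cmod[of "cnj w * T n"] by linarith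
  then show "nonneg (point_state x n w (adj a \<odot> a))" by (simp add: eq nonneg_def)
next
  show "point_state x n w lone = 1"
    using assms by (simp add: point_state_def lone_def emb_def)
qed

text \<open>Polarisation over w = 0, 1, \<i>: the coefficient is (-1 - \<i>) times the first value,
  plus the second, plus \<i> times the third. For n = 0 the value at w = 0 alone suffices, with m =
  1.\<close>

lemma coefficient_from_point_states:
  "\<exists>m \<gamma>\<^sub>0 \<gamma>\<^sub>1 \<gamma>\<^sub>2. m \<noteq> 0 \<and> cmod \<gamma>\<^sub>0 \<le> 2 \<and> cmod \<gamma>\<^sub>1 \<le> 1 \<and> cmod \<gamma>\<^sub>2 \<le> 1 \<and>
    (\<forall>a x. a n x = \<gamma>\<^sub>0 * point_state x m 0 a + \<gamma>\<^sub>1 * point_state x m 1 a + \<gamma>\<^sub>2 * point_state x m \<i> a)"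
proof (cases "n = 0")
  case True
  show ?thesis
    by (rule exI[of _ 1], rule exI[of _ 1], rule exI[of _ 0], rule exI[of _ 0])
       (auto simp: point_state_def True)
next
  case False
  have "cmod (- 1 - \<i>) \<le> 2" using norm_triangle_ineq4[of "-1" \<i>] by simp
  with False show ?thesis
    by (intro exI[of _ n] exI[of _ "- 1 - \<i>"] exI[of _ 1] exI[of _ \<i>])
       (auto simp: point_state_def field_simps)
qed

lemma poscone_square: "a \<in> l1space \<Longrightarrow> adj a \<odot> a \<in> poscone \<sigma>"
  unfolding poscone_def by (rule CollectI, rule exI[of _ "1::nat"], rule exI[of _ "\<lambda>_. a"]) auto

end

section \<open>Consequences of having a positive projection\<close>

locale positive_projection = compact_dynamics +
  fixes E :: "'a elt \<Rightarrow> 'a elt"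
  assumes E: "is_pos_proj \<sigma> E"
begin

lemma E_comm1: "a \<in> l1space \<Longrightarrow> E a \<in> comm1 \<sigma>"
  using E by (auto simp: is_pos_proj_def is_proj_def)

lemma E_fixes_comm1: "b \<in> comm1 \<sigma> \<Longrightarrow> E b = b"
  using E unfolding is_pos_proj_def is_proj_def by (metis imageE)

lemma E_ladd: "a \<in> l1space \<Longrightarrow> b \<in> l1space \<Longrightarrow> E (ladd a b) = ladd (E a) (E b)"
  using E by (simp add: is_pos_proj_def is_proj_def)

lemma E_lscale: "a \<in> l1space \<Longrightarrow> E (lscale c a) = lscale c (E a)"
  using E by (simp add: is_pos_proj_def is_proj_def)

lemma positive_functional_comp_E:
  assumes "is_state \<sigma> \<phi>" shows "positive_functional l1space (\<lambda>a. \<phi> (E a))"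
  unfolding positive_functional_def
proof (intro conjI ballI allI)
  fix a b :: "'a elt" and c assume "a \<in> l1space"
  then show "\<phi> (E (lscale c a)) = c * \<phi> (E a)"
    using assms by (simp add: E_lscale is_state_def E_comm1)
  show "nonneg (\<phi> (E (adj a \<odot> a)))"
    using \<open>a \<in> l1space\<close> E assms poscone_square unfolding is_pos_proj_def by blast
  assume "b \<in> l1space"
  then show "\<phi> (E (ladd a b)) = \<phi> (E a) + \<phi> (E b)"
    using assms \<open>a \<in> l1space\<close> by (simp add: E_ladd is_state_def E_comm1)
next
  show "\<phi> (E lone) = 1"
    using assms by (simp add: E_fixes_comm1 comm1_lone is_state_def)
qed

text \<open>The constant is (2 + 1 + 1) times 2: the bounds on the polarisation coefficients times
  the bound for positive functionals.\<close>

lemma E_coefficient_bound: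
  assumes "a \<in> l1space" shows "cmod (E a n x) \<le> 8 * l1norm a"
proof -
  obtain m \<gamma>\<^sub>0 \<gamma>\<^sub>1 \<gamma>\<^sub>2 where m: "m \<noteq> 0" and \<gamma>: "cmod \<gamma>\<^sub>0 \<le> 2" "cmod \<gamma>\<^sub>1 \<le> 1" "cmod \<gamma>\<^sub>2 \<le> 1"
    and eq: "\<And>a x. a n x = \<gamma>\<^sub>0 * point_state x m 0 a + \<gamma>\<^sub>1 * point_state x m 1 a + \<gamma>\<^sub>2 * point_state x m \<i> a"
    using coefficient_from_point_states[of n] by blast
  have b: "cmod (point_state x m w (E a)) \<le> 2 * l1norm a" if "cmod w \<le> 1" for w
    using positive_functional_bound[OF positive_functional_comp_E[OF point_state[OF m that]] _ assms] by blast
  have "cmod (E a n x) \<le> cmod (\<gamma>\<^sub>0 * point_state x m 0 (E a)) + cmod (\<gamma>\<^sub>1 * point_state x m 1 (E a))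
      + cmod (\<gamma>\<^sub>2 * point_state x m \<i> (E a))"
    unfolding eq[of "E a"] by (meson add_mono norm_triangle_le order_refl)
  also have "\<dots> \<le> 2 * (2 * l1norm a) + 1 * (2 * l1norm a) + 1 * (2 * l1norm a)"
    unfolding norm_mult using \<gamma> b[of 0] b[of 1] b[of \<i>] by (intro add_mono mult_mono) auto
  finally show ?thesis by simp
qed

text \<open>The state \<open>point_state x m w \<circ> E\<close> restricts to the character \<open>f \<mapsto> f x\<close> on \<open>C(X)\<close>, so
  \<open>C(X)\<close> lies in its multiplicative domain.\<close>

lemma point_state_E_emb:
  assumes "m \<noteq> 0" "cmod w \<le> 1" "contfun f" "a \<in> l1space"
  shows "point_state x m w (E (emb f \<odot> a)) = f x * point_state x m w (E a)"
    and "point_state x m w (E (a \<odot> emb f)) = f x * point_state x m w (E a)"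
proof -
  let ?\<psi> = "\<lambda>a. point_state x m w (E a)"
  have \<psi>: "positive_functional l1space ?\<psi>"
    by (rule positive_functional_comp_E[OF point_state[OF assms(1,2)]])
  have add: "?\<psi> (ladd c d) = ?\<psi> c + ?\<psi> d" if "c \<in> l1space" "d \<in> l1space" for c d
    using \<psi> that by (simp add: positive_functional_def)
  have scale: "?\<psi> (lscale r c) = r * ?\<psi> c" if "c \<in> l1space" for c r
    using \<psi> that by (simp add: positive_functional_def)
  have deg: "?\<psi> (adj (emb h) \<odot> b) = 0 \<and> ?\<psi> (adj b \<odot> emb h) = 0"
    if h: "contfun h" "h x = 0" and b: "b \<in> l1space" for h b
  proof (rule positive_functional_degenerate[OF \<psi> emb_l1[OF h(1)] _ b])
    have eq: "adj (emb h) \<odot> emb h = emb (\<lambda>y. cnj (h y) * h y)"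
      unfolding lstar_emb by (intro ext) (simp only: emb_lmult, simp add: emb_def)
    have "contfun (\<lambda>y. cnj (h y) * h y)"
      using h(1) by (auto simp: contfun_def intro!: continuous_intros)
    then show "?\<psi> (adj (emb h) \<odot> emb h) = 0"
      using h(2) assms(1) by (simp add: eq E_fixes_comm1 comm1_emb point_state_def) (simp add: emb_def)
  qed
  \<comment> \<open>Subtracting the value at x gives a function whose squared modulus is sent to 0.
    Left multiplication uses \<open>deg\<close> for the conjugate of h, right multiplication uses it
    for h and \<open>adj a\<close>.\<close>
  define h where "h = (\<lambda>y. f y - f x)"
  have h: "contfun h" "h x = 0" "contfun (\<lambda>y. cnj (h y))"
    using assms(3) by (auto simp: h_def contfun_def intro!: continuous_intros)
  have "emb f \<odot> a = ladd (emb h \<odot> a) (lscale (f x) a)"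
    by (intro ext) (simp add: ladd_def lscale_def emb_lmult h_def algebra_simps)
  moreover have "?\<psi> (emb h \<odot> a) = 0"
    using deg[OF h(3) _ assms(4)] h(2) by (simp add: lstar_emb)
  ultimately show "?\<psi> (emb f \<odot> a) = f x * ?\<psi> a"
    using add[of "emb h \<odot> a" "lscale (f x) a"] scale assms(4) h(1) by (simp add: lmult_l1 emb_l1 lscale_l1)
  have "a \<odot> emb f = ladd (a \<odot> emb h) (lscale (f x) a)"
    by (intro ext) (simp add: ladd_def lscale_def lmult_emb h_def algebra_simps)
  moreover have "?\<psi> (a \<odot> emb h) = 0"
    using deg[OF h(1,2) lstar_l1(1)[OF assms(4)]] by (simp add: lstar_lstar)
  ultimately show "?\<psi> (a \<odot> emb f) = f x * ?\<psi> a"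
    using add[of "a \<odot> emb h" "lscale (f x) a"] scale assms(4) h(1) by (simp add: lmult_l1 emb_l1 lscale_l1)
qed

text \<open>Coefficients at x are combinations of point states at the same x, so the factor f(x)
  comes out on either side.\<close>

lemma E_emb:
  assumes "contfun f" "a \<in> l1space"
  shows "E (emb f \<odot> a) n x = f x * E a n x" and "E (a \<odot> emb f) n x = f x * E a n x"
proof -
  obtain m \<gamma>\<^sub>0 \<gamma>\<^sub>1 \<gamma>\<^sub>2 where m: "m \<noteq> 0"
    and eq: "\<And>a x. a n x = \<gamma>\<^sub>0 * point_state x m 0 a + \<gamma>\<^sub>1 * point_state x m 1 a + \<gamma>\<^sub>2 * point_state x m \<i> a"
    using coefficient_from_point_states[of n] by blast
  note ps = point_state_E_emb[OF m _ assms]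
  show "E (emb f \<odot> a) n x = f x * E a n x" "E (a \<odot> emb f) n x = f x * E a n x"
    unfolding eq[of "E _"] by (simp_all add: ps algebra_simps)
qed

lemma E_single:
  assumes g: "contfun g"
  shows "E (single k g) n x = indicator (FixI k) x * single k g n x"
proof (cases "x \<in> FixI k")
  case True
  then obtain h where h: "contfun h" "h x = 1" "\<And>y. y \<notin> FixI k \<Longrightarrow> h y = 0"
    using bump_function[of "FixI k" x] by auto
  \<comment> \<open>Cutting down to \<open>FixI k\<close> gives an element of the commutant, which E
    fixes; at x the cut-off factor is 1.\<close>
  have "emb h \<odot> single k g \<in> comm1 \<sigma>"
    unfolding comm1_iff
  proof (intro conjI allI impI)
    show "emb h \<odot> single k g \<in> l1space" by (intro lmult_l1 emb_l1 single_l1 h g)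
    fix j y assume "(emb h \<odot> single k g) j y \<noteq> 0"
    then have "h y \<noteq> 0" "j = k" by (auto simp: emb_lmult single_def split: if_splits)
    then show "s j y = y" using h(3) FixI_imp by blast
  qed
  then have "E (emb h \<odot> single k g) n x = (emb h \<odot> single k g) n x"
    by (simp add: E_fixes_comm1)
  then show ?thesis using True E_emb(1)[OF h(1) single_l1(1)[OF g]] by (simp add: emb_lmult h(2))
next
  case False
  define u where "u = E (single k g)"
  have u: "contfun (u n)" using E_comm1[OF single_l1(1)[OF g]] by (simp add: u_def comm1_l1 l1_contfun)
  \<comment> \<open>Moving f through \<delta>^k composes it with \<open>s (- k)\<close>, while E
    pulls functions out of both sides untwisted.\<close>
  have eq: "f y * u n y = f (s (- k) y) * u n y" if f: "contfun f" for f y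
  proof -
    have "single k g \<odot> emb f = emb (\<lambda>y. f (s (- k) y)) \<odot> single k g"
      by (intro ext) (simp add: lmult_emb emb_lmult single_def)
    then show ?thesis
      using E_emb(2)[OF f single_l1(1)[OF g, of k], of n y]
        E_emb(1)[OF contfun_sigpow[OF f] single_l1(1)[OF g, of k], of "- k" n y]
      by (auto simp: u_def)
  qed
  have "y \<in> Fix \<sigma> k" if nz: "u n y \<noteq> 0" for y
  proof (rule ccontr)
    assume "y \<notin> Fix \<sigma> k"
    then have "y \<in> - {s (- k) y}" using sigpow_minus_fixed[of k y] by (auto simp: mem_Fix)
    then obtain f :: "'a \<Rightarrow> complex" where "contfun f" "f y = 1" "f (s (- k) y) = 0"
      using bump_function[of "- {s (- k) y}" y] by auto
    with eq[of f y] nz show False by simp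
  qed
  then have "{y. u n y \<noteq> 0} \<subseteq> Fix \<sigma> k" by auto
  moreover have "open {y. u n y \<noteq> 0}"
    using u unfolding contfun_def by (intro open_Collect_neq continuous_intros)
  ultimately have "{y. u n y \<noteq> 0} \<subseteq> FixI k" by (rule interior_maximal)
  with False show ?thesis by (auto simp: u_def)
qed

lemma E_restr_finite:
  assumes a: "a \<in> l1space" and "finite K"
  shows "E (restr K a) n x = indicator (FixI n) x * restr K a n x"
  using assms(2)
proof (induction K rule: finite_induct)
  case empty
  have "restr {} a = lscale 0 a" by (simp add: restr_def lscale_def)
  then show ?case using E_lscale[OF a, of 0] by (simp add: lscale_def)
next
  case (insert k K)
  have "restr (insert k K) a = ladd (single k (a k)) (restr K a)"
    using insert by (intro ext) (auto simp: restr_def ladd_def single_def)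
  then show ?case
    using insert E_ladd[OF single_l1(1)[OF l1_contfun[OF a, of k], of k] restr_l1(1)[OF a, of K]] E_single[OF l1_contfun[OF a, of k], of k n x]
    by (auto simp: ladd_def single_def restr_def)
qed

lemma E_formula:
  assumes a: "a \<in> l1space"
  shows "E a = (\<lambda>k x. indicator (FixI k) x * a k x)"
proof (intro ext)
  fix n x
  have "cmod (E a n x - indicator (FixI n) x * a n x) \<le> e" if e: "e > 0" for e
  proof -
    \<comment> \<open>The tail enters twice, with factor 8 through E and factor 1 through the
      formula; hence e / 9.\<close>
    obtain K where K: "finite K" "l1norm (restr (- K) a) \<le> e / 9"
      using restr_tail_small[OF a, of "e / 9"] e by auto
    note r = restr_l1(1)[OF a]
    have "E a n x = indicator (FixI n) x * restr K a n x + E (restr (- K) a) n x"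
      using E_ladd[OF r r, of K "- K", folded restr_split] E_restr_finite[OF a K(1)]
      by (simp add: ladd_def)
    moreover have "a n x = restr K a n x + restr (- K) a n x" by (simp add: restr_def)
    ultimately have "E a n x - indicator (FixI n) x * a n x
        = E (restr (- K) a) n x - indicator (FixI n) x * restr (- K) a n x"
      by (simp add: algebra_simps)
    also have "cmod \<dots> \<le> 8 * l1norm (restr (- K) a) + 1 * l1norm (restr (- K) a)"
    proof (intro norm_triangle_le_diff add_mono)
      show "cmod (E (restr (- K) a) n x) \<le> 8 * l1norm (restr (- K) a)"
        by (rule E_coefficient_bound[OF r])
      show "cmod (indicator (FixI n) x * restr (- K) a n x) \<le> 1 * l1norm (restr (- K) a)"
        unfolding norm_mult by (intro mult_mono cmod_le_l1norm r) (auto simp: indicator_def)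
    qed
    finally show ?thesis using K(2) by simp
  qed
  then have "cmod (E a n x - indicator (FixI n) x * a n x) \<le> 0" by (rule dense_ge)
  then show "E a n x = indicator (FixI n) x * a n x" by simp
qed

text \<open>The image of \<delta>^k has the indicator of \<open>FixI k\<close> as a coefficient, and
  coefficients are continuous.\<close>

lemma closed_FixI: "closed (FixI k)"
proof -
  let ?g = "\<lambda>x::'a. 1::complex"
  have "contfun (E (single k ?g) k)"
    using E_comm1[OF single_l1(1)[OF contfun_const]] by (simp add: comm1_l1 l1_contfun)
  moreover have "E (single k ?g) k = indicator (FixI k)"
    by (intro ext) (simp add: E_single[OF contfun_const], simp add: single_def)
  ultimately have "continuous_on UNIV (indicator (FixI k) :: 'a \<Rightarrow> complex)" by (simp add: contfun_def)
  then have "closed {x. indicator (FixI k) x = (1::complex)}"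
    by (intro closed_Collect_eq continuous_intros)
  moreover have "{x. indicator (FixI k) x = (1::complex)} = FixI k" by (auto simp: indicator_def)
  ultimately show ?thesis by simp
qed

end

lemma nonneg_approx:
  assumes "\<And>e. 0 < e \<Longrightarrow> \<exists>w. nonneg w \<and> cmod (z - w) \<le> e"
  shows "nonneg z"
proof -
  have "\<bar>Im z\<bar> \<le> e \<and> - Re z \<le> e" if e: "0 < e" for e
  proof -
    obtain w where w: "nonneg w" "cmod (z - w) \<le> e" using assms[OF e] by blast
    then show ?thesis
      using abs_Re_le_cmod[of "z - w"] abs_Im_le_cmod[of "z - w"] by (auto simp: nonneg_def)
  qed
  then have "\<bar>Im z\<bar> \<le> 0" "- Re z \<le> 0" by (blast intro: dense_ge)+
  then show ?thesis by (simp add: nonneg_def)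
qed

lemma nonneg_sum: "(\<And>j. j \<in> K \<Longrightarrow> nonneg (f j)) \<Longrightarrow> nonneg (\<Sum>j\<in>K. f j)"
  by (auto simp: nonneg_def intro: sum_nonneg)

context compact_dynamics
begin

text \<open>The candidate for the projection. Its coefficients are shown to be continuous only once
  the sets \<open>FixI k\<close> are closed.\<close>

definition condexp :: "'a elt \<Rightarrow> 'a elt" where
  "condexp a = (\<lambda>k x. indicator (FixI k) x * a k x)"

lemma condexp_comm1_eq: "b \<in> comm1 \<sigma> \<Longrightarrow> condexp b = b"
  using comm1_support by (fastforce simp: condexp_def indicator_def)

lemma condexp_lstar: "condexp (adj a) = adj (condexp a)"
  by (intro ext) (auto simp: condexp_def lstar_def indicator_def FixI_minus FixI_sigpow)

text \<open>Where \<open>a k x\<close> is nonzero, k belongs to the subgroup at x, so n and n - k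
  belong to it simultaneously; \<open>FixI_sigpow\<close> absorbs the twist.\<close>

lemma condexp_lmult_left:
  assumes "a \<in> comm1 \<sigma>" shows "condexp (a \<odot> l) = a \<odot> condexp l"
proof (intro ext)
  fix n x
  have eq: "indicator (FixI n) x * (a k x * l (n - k) (s (- k) x))
      = a k x * (indicator (FixI (n - k)) (s (- k) x) * l (n - k) (s (- k) x))" for k
  proof (cases "a k x = 0")
    case False
    then have "x \<in> FixI k" by (rule comm1_support[OF assms])
    then show ?thesis by (simp add: indicator_def FixI_sigpow FixI_diff_iff)
  qed simp
  show "condexp (a \<odot> l) n x = (a \<odot> condexp l) n x"
    by (simp only: condexp_def lmult_def eq flip: infsum_cmult_right')
qed

lemma condexp_lmult_right:
  assumes "b \<in> comm1 \<sigma>" shows "condexp (l \<odot> b) = condexp l \<odot> b"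
proof (intro ext)
  fix n x
  have eq: "indicator (FixI n) x * (l k x * b (n - k) (s (- k) x))
      = indicator (FixI k) x * l k x * b (n - k) (s (- k) x)" for k
  proof (cases "b (n - k) (s (- k) x) = 0")
    case False
    then have "s (- k) x \<in> FixI (n - k)" by (rule comm1_support[OF assms])
    then have "x \<in> FixI (n - k)" by (simp add: FixI_sigpow)
    then have "x \<in> FixI k \<longleftrightarrow> x \<in> FixI n" using FixI_diff_iff[of x "n - k" n] by simp
    then show ?thesis by (simp add: indicator_def)
  qed simp
  show "condexp (l \<odot> b) n x = (condexp l \<odot> b) n x"
    by (simp only: condexp_def lmult_def eq flip: infsum_cmult_right')
qed

lemma l1_sum:
  assumes "finite K" "\<And>j. j \<in> K \<Longrightarrow> (u j :: 'a elt) \<in> l1space"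
  shows "(\<lambda>n x. \<Sum>j\<in>K. u j n x) \<in> l1space"
  using assms
proof (induction K rule: finite_induct)
  case empty
  have "(\<lambda>n x. 0) = lscale 0 (lone :: 'a elt)" by (simp add: lscale_def)
  then show ?case using lscale_l1(1)[OF lone_l1] by simp
next
  case (insert j K)
  have "(\<lambda>n x. \<Sum>i\<in>insert j K. u i n x) = ladd (u j) (\<lambda>n x. \<Sum>i\<in>K. u i n x)"
    using insert by (simp add: ladd_def)
  then show ?case using insert by (simp add: ladd_l1)
qed

lemma poscone_l1:
  assumes "a \<in> poscone \<sigma>" shows "a \<in> l1space"
proof -
  obtain m :: nat and l where l: "\<And>j. j < m \<Longrightarrow> l j \<in> l1space"
    and a: "a = (\<lambda>n x. \<Sum>j<m. (adj (l j) \<odot> l j) n x)"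
    using assms by (auto simp: poscone_def)
  show ?thesis unfolding a by (rule l1_sum) (use l in \<open>auto intro: lmult_l1 lstar_l1\<close>)
qed

lemma lstar_lmult_self_0:
  assumes "a \<in> l1space"
  shows "(adj a \<odot> a) 0 x = of_real (\<Sum>\<^sub>\<infinity>k. (cmod (a k (s k x)))\<^sup>2)"
proof -
  have "(adj a \<odot> a) 0 x = (\<Sum>\<^sub>\<infinity>k. of_real ((cmod (a k (s k x)))\<^sup>2))"
    unfolding lstar_lmult_self by (intro infsum_cong) (metis add_0 complex_norm_square mult.commute)
  also have "\<dots> = of_real (\<Sum>\<^sub>\<infinity>k. (cmod (a k (s k x)))\<^sup>2)"
    by (rule infsumI, rule has_sum_of_real) (use l1_square_summable[OF assms] in simp)
  finally show ?thesis .
qed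

text \<open>The coefficient at 0 is a sum of squared moduli over all j and k, so each of them
  vanishes.\<close>

lemma poscone_zero:
  assumes "a \<in> poscone \<sigma>" "\<And>x. a 0 x = 0" shows "a = lzero"
proof -
  obtain m :: nat and l where l: "\<And>j. j < m \<Longrightarrow> l j \<in> l1space"
    and a: "a = (\<lambda>n x. \<Sum>j<m. (adj (l j) \<odot> l j) n x)"
    using assms(1) by (auto simp: poscone_def)
  define S where "S j x = (\<Sum>\<^sub>\<infinity>k. (cmod (l j k (s k x)))\<^sup>2)" for j x
  have S0: "0 \<le> S j x" for j x unfolding S_def by (rule infsum_nonneg) simp
  have "l j = lzero" if j: "j < m" for j
  proof (intro ext)
    fix k y
    \<comment> \<open>This choice makes \<open>s k x\<close> equal to y, so that the vanishing term
      is the coefficient of l(j) at k and y.\<close>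
    define x where "x = s (- k) y"
    have "complex_of_real (\<Sum>j<m. S j x) = a 0 x"
      using l by (simp add: a lstar_lmult_self_0 S_def)
    then have "(\<Sum>j<m. S j x) = 0" using assms(2) by (metis of_real_eq_0_iff)
    then have "S j x = 0" using S0 j by (simp add: sum_nonneg_eq_0_iff)
    then have "(cmod (l j k (s k x)))\<^sup>2 = 0"
      using l1_square_summable[OF l[OF j], of "\<lambda>k. s k x"] unfolding S_def
      by (intro nonneg_infsum_le_0D[where A = UNIV and f = "\<lambda>k. (cmod (l j k (s k x)))\<^sup>2" and x = k]) auto
    then show "l j k y = lzero k y" by (simp add: x_def lzero_def)
  qed
  then have "(adj (l j) \<odot> l j) n x = 0" if "j < m" for j n x
    using that by (simp add: lmult_def lzero_def)
  then show ?thesis by (simp add: a lzero_def)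
qed

lemma comm00_eq: "comm00 \<sigma> = c00space \<inter> comm1 \<sigma>"
  by (auto simp: comm00_def comm1_def c00space_def)

lemma state_sum:
  assumes \<phi>: "is_state \<sigma> \<phi>" and "finite K" "\<And>j. j \<in> K \<Longrightarrow> u j \<in> comm1 \<sigma>"
  shows "(\<lambda>n x. \<Sum>j\<in>K. u j n x) \<in> comm1 \<sigma> \<and> \<phi> (\<lambda>n x. \<Sum>j\<in>K. u j n x) = (\<Sum>j\<in>K. \<phi> (u j))"
  using assms(2,3)
proof (induction K rule: finite_induct)
  case empty
  have "(\<lambda>n x. 0) = lscale 0 (lone :: 'a elt)" by (simp add: lscale_def)
  moreover have "\<phi> (lscale 0 lone) = 0" using \<phi> comm1_lone by (simp add: is_state_def)
  ultimately show ?case using comm1_lscale[OF comm1_lone] by simp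
next
  case (insert j K)
  have "(\<lambda>n x. \<Sum>i\<in>insert j K. u i n x) = ladd (u j) (\<lambda>n x. \<Sum>i\<in>K. u i n x)"
    using insert by (simp add: ladd_def)
  then show ?case using insert \<phi> by (simp add: comm1_ladd is_state_def)
qed

end

section \<open>Faithfulness, norm, bimodule property and finite sums\<close>

context positive_projection
begin

lemma E_eq_condexp: "a \<in> l1space \<Longrightarrow> E a = condexp a"
  by (simp add: condexp_def E_formula)

lemma E_faithful: "faithful \<sigma> E"
  unfolding faithful_def
proof (intro ballI impI)
  fix a assume a: "a \<in> poscone \<sigma>" "E a = lzero"
  then have "condexp a 0 x = lzero 0 x" for x
    using E_eq_condexp[OF poscone_l1] by simp
  then have "a 0 x = 0" for x by (simp add: condexp_def FixI_0 lzero_def)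
  then show "a = lzero" by (rule poscone_zero[OF a(1)])
qed

lemma E_involutive: "involutive \<sigma> E"
  by (simp add: involutive_def E_eq_condexp lstar_l1 condexp_lstar)

lemma E_norm_one: "norm_one E"
  unfolding norm_one_def
proof (intro conjI ballI)
  fix a :: "'a elt" assume a: "a \<in> l1space"
  have 1: "contfun (E a k)" for k using E_comm1[OF a] by (simp add: comm1_l1 l1_contfun)
  have 2: "cmod (E a k x) \<le> supnorm (a k)" for k x
    using l1_cmod_le[OF a] l1_supnorm_nonneg[OF a] by (simp add: E_formula[OF a] indicator_def)
  show "l1norm (E a) \<le> l1norm a"
    using l1I(2)[OF 1 2 l1_summable[OF a]] by (simp add: l1norm_def)
next
  have "lone \<noteq> (lzero :: 'a elt)" by (auto simp: lone_def lzero_def emb_def fun_eq_iff)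
  then show "\<exists>a\<in>l1space. a \<noteq> lzero \<and> l1norm (E a) = l1norm a"
    by (intro bexI[of _ lone]) (auto simp: lone_l1 E_fixes_comm1 comm1_lone)
qed

lemma E_bimodule_morphism: "bimodule_morphism \<sigma> E"
  by (simp add: bimodule_morphism_def E_eq_condexp lmult_l1 comm1_l1 condexp_lmult_left condexp_lmult_right)

lemma E_image_c00space: "E ` c00space = comm00 \<sigma>"
proof
  show "E ` c00space \<subseteq> comm00 \<sigma>"
  proof clarify
    fix a :: "'a elt" assume a: "a \<in> c00space"
    then have a1: "a \<in> l1space" and fin: "finite {k. a k \<noteq> (\<lambda>x. 0)}" by (auto simp: c00space_def)
    have "{k. E a k \<noteq> (\<lambda>x. 0)} \<subseteq> {k. a k \<noteq> (\<lambda>x. 0)}"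
      by (auto simp: E_formula[OF a1])
    then have "finite {k. E a k \<noteq> (\<lambda>x. 0)}" by (rule finite_subset[OF _ fin])
    then show "E a \<in> comm00 \<sigma>" using E_comm1[OF a1] by (simp add: comm00_eq c00space_def comm1_l1)
  qed
  show "comm00 \<sigma> \<subseteq> E ` c00space"
  proof
    fix b assume "b \<in> comm00 \<sigma>"
    then show "b \<in> E ` c00space" using E_fixes_comm1 by (intro image_eqI[of _ _ b]) (auto simp: comm00_eq)
  qed
qed

end

subsection \<open>Existence of the projection\<close>

locale clopen_dynamics = compact_dynamics +
  assumes closed_FixI: "\<And>k. closed (FixI k)"
begin

lemma contfun_clopen:
  assumes "contfun f" "open S" "closed S"
  shows "contfun (\<lambda>x. if x \<in> S then f x else 0)"
proof -
  have "continuous_on (S \<union> - S) (\<lambda>x. if x \<in> S then f x else 0)"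
    by (rule continuous_on_cases)
       (use assms in \<open>auto simp: contfun_def closed_Compl intro: continuous_on_subset\<close>)
  then show ?thesis by (simp add: contfun_def)
qed

lemma condexp_comm1:
  assumes "a \<in> l1space"
  shows "condexp a \<in> comm1 \<sigma>" "l1norm (condexp a) \<le> l1norm a"
proof -
  have "condexp a k = (\<lambda>x. if x \<in> FixI k then a k x else 0)" for k
    by (auto simp: condexp_def indicator_def)
  then have 1: "contfun (condexp a k)" for k
    using contfun_clopen[OF l1_contfun[OF assms] open_interior closed_FixI] by simp
  have 2: "cmod (condexp a k x) \<le> supnorm (a k)" for k x
    using l1_cmod_le[OF assms] l1_supnorm_nonneg[OF assms] by (simp add: condexp_def indicator_def)
  note 3 = l1I[OF 1 2 l1_summable[OF assms]]
  show "l1norm (condexp a) \<le> l1norm a" using 3(2) by (simp add: l1norm_def)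
  show "condexp a \<in> comm1 \<sigma>"
    using 3(1) by (auto simp: comm1_iff condexp_def indicator_def FixI_imp split: if_splits)
qed

text \<open>\<open>least_rep K j\<close> is the set of \<open>x\<close> for which \<open>j\<close> is the least element of \<open>K\<close> in its coset at \<open>x\<close>.\<close>

definition least_rep :: "int set \<Rightarrow> int \<Rightarrow> 'a set" where
  "least_rep K j = {x. \<forall>i\<in>K. i < j \<longrightarrow> x \<notin> FixI (j - i)}"

lemma least_rep_clopen:
  assumes "finite K" shows "open (least_rep K j)" "closed (least_rep K j)"
proof -
  have eq: "least_rep K j = (\<Inter>i\<in>{i\<in>K. i < j}. - FixI (j - i))"
    by (auto simp: least_rep_def)
  show "open (least_rep K j)" unfolding eq using assms closed_FixI by (intro open_INT) auto
  show "closed (least_rep K j)" unfolding eq by (intro closed_INT) auto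
qed

text \<open>Existence takes the minimum of K inside the coset of k at x; two such representatives
  would differ by an element of the subgroup, contradicting minimality of the larger one.\<close>

lemma least_rep_ex1:
  assumes "finite K" "k \<in> K"
  shows "\<exists>!j. j \<in> K \<and> x \<in> least_rep K j \<and> x \<in> FixI (k - j)"
proof (rule ex_ex1I)
  let ?C = "{i\<in>K. x \<in> FixI (k - i)}"
  have fin: "finite ?C" and ne: "?C \<noteq> {}" using assms FixI_0 by auto
  define j where "j = Min ?C"
  have j: "j \<in> K" "x \<in> FixI (k - j)" using Min_in[OF fin ne] by (auto simp: j_def)
  have "x \<in> least_rep K j"
    unfolding least_rep_def
  proof (intro CollectI ballI impI notI)
    fix i assume i: "i \<in> K" "i < j" "x \<in> FixI (j - i)"
    then have "x \<in> FixI (k - i)" using FixI_add[OF j(2) i(3)] by simp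
    then have "j \<le> i" unfolding j_def using i(1) fin by (intro Min_le) auto
    with i(2) show False by simp
  qed
  with j show "\<exists>j. j \<in> K \<and> x \<in> least_rep K j \<and> x \<in> FixI (k - j)" by blast
next
  have aux: False if "i \<in> K" "x \<in> FixI (k - i)" "x \<in> least_rep K j" "x \<in> FixI (k - j)" "i < j" for i j
  proof -
    have "x \<in> FixI (j - i)" using FixI_diff[OF that(2,4)] by simp
    with that show False by (auto simp: least_rep_def)
  qed
  show "i = j" if "i \<in> K \<and> x \<in> least_rep K i \<and> x \<in> FixI (k - i)"
    "j \<in> K \<and> x \<in> least_rep K j \<and> x \<in> FixI (k - j)" for i j
    using aux[of i j] aux[of j i] that by (cases i j rule: linorder_cases) auto
qed

text \<open>The part of l in the coset of j, moved back by j so that its indices lie in the subgroup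
  at x. The argument \<open>s j x\<close> matches the one occurring in
  \<open>lstar_lmult_self\<close>.\<close>

definition coset_part :: "int set \<Rightarrow> 'a elt \<Rightarrow> int \<Rightarrow> 'a elt" where
  "coset_part K l j = (\<lambda>n x. if x \<in> least_rep K j \<inter> FixI n then l (n + j) (s j x) else 0)"

lemma coset_part_comm1:
  assumes "finite K" "l \<in> l1space" shows "coset_part K l j \<in> comm1 \<sigma>"
  unfolding comm1_iff
proof (intro conjI allI impI)
  have 1: "contfun (coset_part K l j n)" for n
    unfolding coset_part_def
    using least_rep_clopen[OF assms(1)] closed_FixI
    by (intro contfun_clopen contfun_sigpow l1_contfun assms) auto
  have 2: "cmod (coset_part K l j n x) \<le> supnorm (l (n + j))" for n x
    using l1_cmod_le[OF assms(2)] l1_supnorm_nonneg[OF assms(2)] by (simp add: coset_part_def)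
  have "(\<lambda>n. supnorm (l (n + j))) summable_on UNIV"
    using l1_summable[OF assms(2)]
    by (subst summable_on_reindex_bij_witness[of _ "\<lambda>k. k - j" "\<lambda>k. k + j" UNIV "\<lambda>k. supnorm (l k)"]) auto
  then show "coset_part K l j \<in> l1space" by (rule l1I(1)[OF 1 2])
qed (auto simp: coset_part_def FixI_imp split: if_splits)

text \<open>For x in \<open>FixI m\<close> the indices k and m + k lie in the same coset, so no
  products mix different cosets; for other x both sides vanish.\<close>

lemma condexp_square_finite:
  assumes K: "finite K" and l: "l \<in> l1space" and supp: "\<And>k x. k \<notin> K \<Longrightarrow> l k x = 0"
  shows "condexp (adj l \<odot> l) = (\<lambda>m x. \<Sum>j\<in>K. (adj (coset_part K l j) \<odot> coset_part K l j) m x)"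
proof (intro ext)
  fix m x
  define c where "c k = (if x \<in> FixI m then cnj (l k (s k x)) * l (m + k) (s k x) else 0)" for k
  have part: "(adj (coset_part K l j) \<odot> coset_part K l j) m x
      = (\<Sum>k\<in>K. if x \<in> least_rep K j \<and> x \<in> FixI (k - j) then c k else 0)" for j
  proof -
    let ?b = "coset_part K l j"
    have "(adj ?b \<odot> ?b) m x = (\<Sum>\<^sub>\<infinity>k. cnj (?b k x) * ?b (m + k) x)"
      by (rule comm1_lstar_lmult_self[OF coset_part_comm1[OF K l]])
    \<comment> \<open>The shift undoes the translation by j, so that k again indexes coefficients of
      l.\<close>
    also have "\<dots> = (\<Sum>\<^sub>\<infinity>k. cnj (?b (k + - j) x) * ?b (m + (k + - j)) x)"
      by (rule infsum_int_shift[symmetric])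
    also have "\<dots> = (\<Sum>\<^sub>\<infinity>k. if x \<in> least_rep K j \<and> x \<in> FixI (k - j) then c k else 0)"
    proof (rule infsum_cong)
      fix k
      show "cnj (?b (k + - j) x) * ?b (m + (k + - j)) x
          = (if x \<in> least_rep K j \<and> x \<in> FixI (k - j) then c k else 0)"
      proof (cases "x \<in> FixI (k - j)")
        case True
        have "s k x = s j x" using FixI_imp[OF True] sigpow_add[of j "k - j" x] by simp
        moreover have "x \<in> FixI (m + (k - j)) \<longleftrightarrow> x \<in> FixI m"
          using FixI_diff_iff[OF True, of "m + (k - j)"] by simp
        ultimately show ?thesis using True by (simp add: coset_part_def c_def)
      qed (simp add: coset_part_def)
    qed
    also have "\<dots> = (\<Sum>\<^sub>\<infinity>k\<in>K. if x \<in> least_rep K j \<and> x \<in> FixI (k - j) then c k else 0)"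
      by (rule infsum_cong_neutral) (auto simp: c_def supp)
    finally show ?thesis using K by simp
  qed
  have "(\<Sum>j\<in>K. (adj (coset_part K l j) \<odot> coset_part K l j) m x)
      = (\<Sum>k\<in>K. \<Sum>j\<in>K. if x \<in> least_rep K j \<and> x \<in> FixI (k - j) then c k else 0)"
    unfolding part by (rule sum.swap)
  also have "\<dots> = (\<Sum>k\<in>K. c k)"
  \<comment> \<open>Each k in K is counted by exactly one representative j.\<close>
  proof (rule sum.cong[OF refl])
    fix k assume "k \<in> K"
    then obtain i where i: "i \<in> K" "\<And>j. j \<in> K \<Longrightarrow> (x \<in> least_rep K j \<and> x \<in> FixI (k - j)) \<longleftrightarrow> j = i"
      using least_rep_ex1[OF K, of k x] by metis
    then have "(\<Sum>j\<in>K. if x \<in> least_rep K j \<and> x \<in> FixI (k - j) then c k else 0)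
        = (\<Sum>j\<in>K. if j = i then c k else 0)"
      by (intro sum.cong) auto
    then show "(\<Sum>j\<in>K. if x \<in> least_rep K j \<and> x \<in> FixI (k - j) then c k else 0) = c k"
      using i(1) K by simp
  qed
  also have "\<dots> = (\<Sum>\<^sub>\<infinity>k\<in>K. c k)" using K by simp
  also have "\<dots> = (\<Sum>\<^sub>\<infinity>k. c k)"
    by (rule infsum_cong_neutral) (auto simp: c_def supp)
  also have "\<dots> = condexp (adj l \<odot> l) m x"
    by (simp add: c_def condexp_def lstar_lmult_self indicator_def)
  finally show "condexp (adj l \<odot> l) m x = (\<Sum>j\<in>K. (adj (coset_part K l j) \<odot> coset_part K l j) m x)" ..
qed

text \<open>For a finite truncation the value is a sum of values at squares in the commutant;
  boundedness of the state and contractivity of \<open>condexp\<close> control the error.\<close>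

lemma state_condexp_square_nonneg:
  assumes \<phi>: "is_state \<sigma> \<phi>" and l: "l \<in> l1space"
  shows "nonneg (\<phi> (condexp (adj l \<odot> l)))"
proof (rule nonneg_approx)
  fix e :: real assume e: "0 < e"
  have cadd: "\<phi> (condexp (ladd a b)) = \<phi> (condexp a) + \<phi> (condexp b)"
    if "a \<in> l1space" "b \<in> l1space" for a b
  proof -
    have "condexp (ladd a b) = ladd (condexp a) (condexp b)"
      by (simp add: condexp_def ladd_def algebra_simps)
    then show ?thesis using \<phi> condexp_comm1(1) that by (simp add: is_state_def)
  qed
  have bound: "cmod (\<phi> (condexp a)) \<le> 2 * l1norm a" if "a \<in> l1space" for a
    using positive_functional_bound[OF \<phi>[unfolded is_state_iff] _ condexp_comm1(1)[OF that]]
      condexp_comm1(2)[OF that] by simp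
  define N where "N = l1norm l"
  have N: "0 \<le> N" using l1norm_nonneg[OF l] by (simp add: N_def)
  \<comment> \<open>The error will be at most 4 N d; the added 1 keeps the denominator positive when
    N = 0.\<close>
  define d where "d = e / (4 * N + 1)"
  have d: "0 < d" using e N by (simp add: d_def)
  obtain K where K: "finite K" "l1norm (restr (- K) l) \<le> d"
    using restr_tail_small[OF l d] .
  define p r where "p = restr K l" and "r = restr (- K) l"
  have pr: "l = ladd p r" unfolding p_def r_def by (rule restr_split)
  have p: "p \<in> l1space" "l1norm p \<le> N" and r: "r \<in> l1space" "l1norm r \<le> d" "l1norm (adj r) \<le> d"
    using restr_l1[OF l] K lstar_l1(2)[OF restr_l1(1)[OF l], of "- K"] by (auto simp: p_def r_def N_def)
  note [simp] = p(1) r(1) l ladd_l1(1) lstar_l1(1) lmult_l1(1)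
  have dec: "adj l \<odot> l = ladd (adj p \<odot> p) (ladd (adj p \<odot> r) (adj r \<odot> l))"
  proof -
    have "adj l \<odot> l = ladd (adj p \<odot> l) (adj r \<odot> l)"
      by (subst pr, simp add: lstar_ladd lmult_ladd_left)
    also have "adj p \<odot> l = ladd (adj p \<odot> p) (adj p \<odot> r)"
      by (subst pr, simp add: lmult_ladd_right)
    finally show ?thesis by (simp add: ladd_def add.assoc)
  qed
  let ?w = "\<phi> (condexp (adj p \<odot> p))" and ?z = "ladd (adj p \<odot> r) (adj r \<odot> l)"
  have "?w = (\<Sum>j\<in>K. \<phi> (adj (coset_part K p j) \<odot> coset_part K p j))"
    using condexp_square_finite[OF K(1) p(1)] state_sum[OF \<phi> K(1)]
    by (simp add: p_def restr_def comm1_lmult comm1_lstar coset_part_comm1[OF K(1) p(1)[unfolded p_def restr_def]])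
  then have w: "nonneg ?w"
    using \<phi> coset_part_comm1[OF K(1) p(1)] by (auto simp: is_state_def intro!: nonneg_sum)
  have "l1norm ?z \<le> l1norm (adj p \<odot> r) + l1norm (adj r \<odot> l)"
    by (rule ladd_l1(2)) simp_all
  also have "\<dots> \<le> l1norm (adj p) * l1norm r + l1norm (adj r) * l1norm l"
    by (intro add_mono lmult_l1(2)) simp_all
  also have "\<dots> \<le> N * d + d * N"
    using p r N d lstar_l1(2)[OF p(1)] by (intro add_mono mult_mono) (auto simp: N_def intro: l1norm_nonneg)
  finally have z: "l1norm ?z \<le> 2 * (N * d)" by simp
  have "\<phi> (condexp (adj l \<odot> l)) - ?w = \<phi> (condexp ?z)"
    unfolding dec by (subst cadd) auto
  moreover have "cmod (\<phi> (condexp ?z)) \<le> 2 * l1norm ?z" by (rule bound) simp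
  ultimately have "cmod (\<phi> (condexp (adj l \<odot> l)) - ?w) \<le> 4 * N * d" using z by simp
  also have "\<dots> \<le> e" using N e by (simp add: d_def field_simps)
  finally show "\<exists>w. nonneg w \<and> cmod (\<phi> (condexp (adj l \<odot> l)) - w) \<le> e" using w by blast
qed

lemma condexp_is_pos_proj: "is_pos_proj \<sigma> condexp"
  unfolding is_pos_proj_def is_proj_def
proof (intro conjI ballI allI impI)
  show "condexp (ladd a b) = ladd (condexp a) (condexp b)" for a b
    by (simp add: condexp_def ladd_def algebra_simps)
  show "condexp (lscale c a) = lscale c (condexp a)" for a c
    by (simp add: condexp_def lscale_def algebra_simps)
  show "condexp (condexp a) = condexp a" for a
    by (intro ext) (simp add: condexp_def indicator_def)
  show "condexp ` l1space = comm1 \<sigma>"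
  proof (intro equalityI subsetI)
    fix b assume "b \<in> comm1 \<sigma>"
    then show "b \<in> condexp ` l1space"
      by (intro image_eqI[of _ _ b]) (auto simp: condexp_comm1_eq comm1_l1)
  qed (auto simp: condexp_comm1)
  fix a \<phi> assume a: "a \<in> poscone \<sigma>" and \<phi>: "is_state \<sigma> \<phi>"
  obtain m :: nat and l where l: "\<And>j. j < m \<Longrightarrow> l j \<in> l1space"
    and eq: "a = (\<lambda>n x. \<Sum>j<m. (adj (l j) \<odot> l j) n x)"
    using a by (auto simp: poscone_def)
  have "condexp a = (\<lambda>n x. \<Sum>j<m. condexp (adj (l j) \<odot> l j) n x)"
    by (simp add: eq condexp_def sum_distrib_left)
  moreover have "condexp (adj (l j) \<odot> l j) \<in> comm1 \<sigma>" if "j < m" for j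
    using l[OF that] by (intro condexp_comm1 lmult_l1 lstar_l1)
  ultimately have "\<phi> (condexp a) = (\<Sum>j<m. \<phi> (condexp (adj (l j) \<odot> l j)))"
    using state_sum[OF \<phi>, of "{..<m}" "\<lambda>j. condexp (adj (l j) \<odot> l j)"] by simp
  then show "nonneg (\<phi> (condexp a))"
    using l by (auto intro!: nonneg_sum state_condexp_square_nonneg[OF \<phi>])
qed

end

theorem theorem5p7:
  fixes \<sigma> :: "'a::t2_space \<Rightarrow> 'a"
  assumes "compact (UNIV :: 'a set)"
    and "bij \<sigma>" and "continuous_on UNIV \<sigma>" and "continuous_on UNIV (inv \<sigma>)"
  shows "((\<forall>k::int. closed (interior (Fix \<sigma> k))) \<longleftrightarrow> (\<exists>E. is_pos_proj \<sigma> E))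
    \<and> (\<forall>E1 E2. is_pos_proj \<sigma> E1 \<and> is_pos_proj \<sigma> E2 \<longrightarrow> (\<forall>a\<in>l1space. E1 a = E2 a))
    \<and> (\<forall>E. is_pos_proj \<sigma> E \<longrightarrow>
         (\<forall>a\<in>l1space. E a = (\<lambda>k x. indicator (interior (Fix \<sigma> k)) x * a k x))
         \<and> faithful \<sigma> E \<and> involutive \<sigma> E \<and> norm_one E \<and> bimodule_morphism \<sigma> E
         \<and> E ` c00space = comm00 \<sigma>)"
proof -
  interpret compact_dynamics \<sigma> using assms by unfold_locales
  have pp: "positive_projection \<sigma> E" if "is_pos_proj \<sigma> E" for E
    using that by unfold_locales
  have ex: "\<exists>E. is_pos_proj \<sigma> E" if "\<forall>k. closed (FixI k)"
  proof -
    interpret clopen_dynamics \<sigma> using that by unfold_locales blast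
    show ?thesis using condexp_is_pos_proj by blast
  qed
  \<comment> \<open>Uniqueness is read off from the formula, which determines every positive
    projection on \<open>l1space\<close>.\<close>
  show ?thesis
    using ex positive_projection.closed_FixI[OF pp] positive_projection.E_formula[OF pp]
      positive_projection.E_faithful[OF pp] positive_projection.E_involutive[OF pp]
      positive_projection.E_norm_one[OF pp] positive_projection.E_bimodule_morphism[OF pp]
      positive_projection.E_image_c00space[OF pp]
    by (intro conjI iffI allI impI ballI) auto
qed

end
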